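(* If a graph $G$ has extreme local rank 1 and $\phi : G \rightarrow H$ is a completely surjective graph homomorphism to a graph $H$, then $\epsilon(G) \le \epsilon(H)$.
   Context: All graphs are finite, undirected, without multiple edges, and every loop $\{i,i\}$ is an edge. A graph homomorphism $\phi:G\to H$ is a map $V(G)\to V(H)$ with $\{\phi(i),\phi(j)\}\in E(H)$ whenever $\{i,j\}\in E(G)$ (so adjacent vertices may be mapped to the same vertex). A clique is a set of pairwise adjacent vertices (singletons included). $G[S]$ is the subgraph induced by $S\subseteq V(G)$. Partial matrices. A $G$-partial matrix is a symmetric real array $X$ with entries $X_{ij}=X_{ji}$ specified exactly for $\{i,j\}\in E(G)$ (including all diagonal entries); the vector space of these is $\mathrm{Sym}(G)$. $\mathcal{S}(G)$ is the cone of $X\in\mathrm{Sym}(G)$ whose unspecified entries can be chosen to give a positive semidefinite (PSD) matrix. $\mathcal{P}(G)$ is the cone of $X\in\mathrm{Sym}(G)$ such that for every clique $C$ of $G$ the submatrix $X|_C$ is PSD. Let $\mathrm{tr}(X)=\sum_i X_{ii}$ and let $I_G$ be the projection of the identity matrix to $\mathrm{Sym}(G)$. Define $\epsilon_G(X)=\min\{\epsilon : X+\epsilon I_G\in\mathcal{S}(G)\}$ and $\epsilon(G)=\max\{\epsilon_G(X):X\in\mathcal{P}(G),\ \mathrm{tr}(X)=1\}$. Extreme local rank. $X\in\mathcal{P}(G)$ is locally rank 1 if $X|_C$ has rank at most 1 for every clique $C$ of $G$. $G$ has extreme local rank 1 if all extreme rays of $\mathcal{P}(G)$ are locally rank 1.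 Cohomology. A cocycle of $G$ is a function $f:E(G)\to\mathbb{Z}/2\mathbb{Z}$, vanishing on loops, with $f(\{i,j\})+f(\{j,k\})+f(\{i,k\})=0$ for every triangle (clique of size 3) $\{i,j,k\}$ of $G$; a coboundary is a function of the form $f(\{i,j\})=d(i)+d(j)$ for some $d:V(G)\to\mathbb{Z}/2\mathbb{Z}$. $H^1(G;\mathbb{Z}/2\mathbb{Z})$ is the group of cocycles modulo coboundaries. A homomorphism $\phi:G\to H$ induces $\phi^*:H^1(H;\mathbb{Z}/2\mathbb{Z})\to H^1(G;\mathbb{Z}/2\mathbb{Z})$ by $\phi^*(f)(\{i,j\})=f(\{\phi(i),\phi(j)\})$. $\phi$ is surjective in degree 1 if this $\phi^*$ is surjective, and completely surjective if for every $S\subseteq V(G)$ the restriction $\phi|_S:G[S]\to H$ is surjective in degree 1.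
   Formalization: G is assumed nonempty, and if H has exactly one vertex then G is assumed to have exactly one too; otherwise the claim fails, e.g. for the constant map from K_2 to the one-vertex graph H, since ε(K_2) = 0 while ε(H) = −1. *)

theory Defs
  imports
    "HOL-Analysis.Analysis"
    "HOL-Library.Z2"
    "HOL-Algebra.Coset"
begin

section \<open>Graphs with all loops\<close>

record 'a graph =
  verts :: "'a set"
  edges :: "'a set set"

text \<open>An edge is a set \<open>{i, j}\<close>; the loop at \<open>i\<close> is \<open>{i, i} = {i}\<close>.
  Vertex sets are subsets of a finite type, not necessarily all of it, so that an induced
  subgraph is again a graph over the same type.\<close>

definition looped_graph :: "'a::finite graph \<Rightarrow> bool" where
  "looped_graph G \<longleftrightarrow>
     edges G \<subseteq> {{i, j} | i j. i \<in> verts G \<and> j \<in> verts G} \<and>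
     (\<forall>i\<in>verts G. {i, i} \<in> edges G)"

definition graph_hom :: "'a graph \<Rightarrow> 'b graph \<Rightarrow> ('a \<Rightarrow> 'b) \<Rightarrow> bool" where
  "graph_hom G H \<phi> \<longleftrightarrow>
     (\<forall>i\<in>verts G. \<phi> i \<in> verts H) \<and>
     (\<forall>i j. {i, j} \<in> edges G \<longrightarrow> {\<phi> i, \<phi> j} \<in> edges H)"

definition clique :: "'a graph \<Rightarrow> 'a set \<Rightarrow> bool" where
  "clique G C \<longleftrightarrow> C \<subseteq> verts G \<and> (\<forall>i\<in>C. \<forall>j\<in>C. {i, j} \<in> edges G)"

definition induced_subgraph :: "'a graph \<Rightarrow> 'a set \<Rightarrow> 'a graph" where
  "induced_subgraph G S = \<lparr>verts = S, edges = {e \<in> edges G. e \<subseteq> S}\<rparr>"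


section \<open>Partial matrices\<close>

definition psd :: "real^'n^'n \<Rightarrow> bool" where
  "psd A \<longleftrightarrow> transpose A = A \<and> (\<forall>v. 0 \<le> v \<bullet> (A *v v))"

text \<open>The principal submatrix with rows and columns in \<open>C\<close>, padded with zeros to the size of the
  ambient type; the padding changes neither its rank nor whether it is positive semidefinite.\<close>

definition principal_submatrix :: "'n set \<Rightarrow> real^'n^'n \<Rightarrow> real^'n^'n" where
  "principal_submatrix C X = (\<chi> i j. if i \<in> C \<and> j \<in> C then X $ i $ j else 0)"

text \<open>A partial matrix is stored with the value 0 at every unspecified position, so that
  the partial matrices form a linear subspace; only the entries at edges carry meaning.\<close>

definition Sym :: "'n::finite graph \<Rightarrow> (real^'n^'n) set" where
  "Sym G = {X. transpose X = X \<and> (\<forall>i j. {i, j} \<notin> edges G \<longrightarrow> X $ i $ j = 0)}"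

definition psd_completable :: "'n::finite graph \<Rightarrow> (real^'n^'n) set" where
  "psd_completable G =
     {X \<in> Sym G. \<exists>Y. (\<forall>i j. {i, j} \<in> edges G \<longrightarrow> Y $ i $ j = X $ i $ j) \<and>
                     psd (principal_submatrix (verts G) Y)}"

definition locally_psd :: "'n::finite graph \<Rightarrow> (real^'n^'n) set" where
  "locally_psd G = {X \<in> Sym G. \<forall>C. clique G C \<longrightarrow> psd (principal_submatrix C X)}"

text \<open>The identity matrix of the vertex set, which is already a partial matrix
  since every loop is an edge.\<close>

definition partial_id :: "'n::finite graph \<Rightarrow> real^'n^'n" where
  "partial_id G = principal_submatrix (verts G) (mat 1)"

text \<open>Both operators below are a genuine minimum and maximum (attained) when the vertex set is
  nonempty.  For the empty graph no partial matrix has trace 1, and \<open>eps_graph\<close> has no meaning.\<close>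

definition eps_matrix :: "'n::finite graph \<Rightarrow> real^'n^'n \<Rightarrow> real" where
  "eps_matrix G X = (LEAST \<epsilon>. X + \<epsilon> *\<^sub>R partial_id G \<in> psd_completable G)"

definition eps_graph :: "'n::finite graph \<Rightarrow> real" where
  "eps_graph G = (GREATEST r. r \<in> {eps_matrix G X | X. X \<in> locally_psd G \<and> trace X = 1})"


section \<open>Extreme local rank\<close>

definition extreme_ray_of :: "'v::real_vector set \<Rightarrow> 'v set \<Rightarrow> bool" where
  "extreme_ray_of R K \<longleftrightarrow> R face_of K \<and> (\<exists>x. x \<noteq> 0 \<and> R = conic hull {x})"

definition locally_rank1 :: "'n::finite graph \<Rightarrow> real^'n^'n \<Rightarrow> bool" where
  "locally_rank1 G X \<longleftrightarrow> (\<forall>C. clique G C \<longrightarrow> rank (principal_submatrix C X) \<le> 1)"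

definition extreme_local_rank1 :: "'n::finite graph \<Rightarrow> bool" where
  "extreme_local_rank1 G \<longleftrightarrow>
     (\<forall>R. extreme_ray_of R (locally_psd G) \<longrightarrow> (\<forall>X\<in>R. locally_rank1 G X))"


section \<open>First cohomology with coefficients in the field with two elements\<close>

text \<open>A function on the edges of \<open>G\<close> is represented by its extension by 0 to all sets.\<close>

definition cocycles :: "'a graph \<Rightarrow> ('a set \<Rightarrow> bit) set" where
  "cocycles G =
     {f. (\<forall>e. e \<notin> edges G \<longrightarrow> f e = 0) \<and>
         (\<forall>i\<in>verts G. f {i, i} = 0) \<and>
         (\<forall>i j k. clique G {i, j, k} \<and> card {i, j, k} = 3 \<longrightarrow>
            f {i, j} + f {j, k} + f {i, k} = 0)}"

definition coboundaries :: "'a graph \<Rightarrow> ('a set \<Rightarrow> bit) set" where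
  "coboundaries G =
     {f. (\<forall>e. e \<notin> edges G \<longrightarrow> f e = 0) \<and>
         (\<exists>d. \<forall>i j. {i, j} \<in> edges G \<longrightarrow> f {i, j} = d i + d j)}"

definition cocycle_group :: "'a graph \<Rightarrow> ('a set \<Rightarrow> bit) monoid" where
  "cocycle_group G =
     \<lparr>carrier = cocycles G, monoid.mult = (\<lambda>f g e. f e + g e), one = (\<lambda>e. 0)\<rparr>"

definition H1 :: "'a graph \<Rightarrow> ('a set \<Rightarrow> bit) set monoid" where
  "H1 G = cocycle_group G Mod coboundaries G"

definition pullback :: "'a graph \<Rightarrow> ('a \<Rightarrow> 'b) \<Rightarrow> ('b set \<Rightarrow> bit) \<Rightarrow> 'a set \<Rightarrow> bit" where
  "pullback G \<phi> f = (\<lambda>e. if e \<in> edges G then f (\<phi> ` e) else 0)"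

text \<open>The induced map takes the class of \<open>f\<close> to the class of its pullback. The union over all
  representatives of the class avoids a choice: all of them yield the same coset, see
  \<open>H1_map_coset\<close> below.\<close>

definition H1_map ::
  "'a graph \<Rightarrow> ('a \<Rightarrow> 'b) \<Rightarrow> ('b set \<Rightarrow> bit) set \<Rightarrow> ('a set \<Rightarrow> bit) set" where
  "H1_map G \<phi> c = (\<Union>f\<in>c. coboundaries G #>\<^bsub>cocycle_group G\<^esub> pullback G \<phi> f)"

definition surjective_in_degree_1 :: "'a graph \<Rightarrow> 'b graph \<Rightarrow> ('a \<Rightarrow> 'b) \<Rightarrow> bool" where
  "surjective_in_degree_1 G H \<phi> \<longleftrightarrow> H1_map G \<phi> ` carrier (H1 H) = carrier (H1 G)"

definition completely_surjective :: "'a graph \<Rightarrow> 'b graph \<Rightarrow> ('a \<Rightarrow> 'b) \<Rightarrow> bool" where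
  "completely_surjective G H \<phi> \<longleftrightarrow>
     (\<forall>S. S \<subseteq> verts G \<longrightarrow> surjective_in_degree_1 (induced_subgraph G S) H \<phi>)"


subsection \<open>The cohomology group and the induced map are well defined\<close>

lemma bit_add_self: "(a::bit) + a = 0"
  by (cases a) simp_all

lemma looped_graph_induced:
  assumes "looped_graph G" "S \<subseteq> verts G"
  shows "looped_graph (induced_subgraph G S)"
proof -
  have "e \<in> {{i, j} | i j. i \<in> S \<and> j \<in> S}" if "e \<in> edges G" "e \<subseteq> S" for e
    using assms(1) that unfolding looped_graph_def by blast
  moreover have "{i, i} \<in> edges G" if "i \<in> S" for i
    using assms that unfolding looped_graph_def by blast
  ultimately show ?thesis
    unfolding looped_graph_def induced_subgraph_def by auto
qed

lemma comm_group_cocycle: "comm_group (cocycle_group G)"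
proof (rule comm_groupI)
  fix f g assume "f \<in> carrier (cocycle_group G)" "g \<in> carrier (cocycle_group G)"
  then have *: "f \<in> cocycles G" "g \<in> cocycles G" by (simp_all add: cocycle_group_def)
  have "(f {i, j} + g {i, j}) + (f {j, k} + g {j, k}) + (f {i, k} + g {i, k}) = 0"
    if "clique G {i, j, k} \<and> card {i, j, k} = 3" for i j k
  proof -
    have "f {i, j} + f {j, k} + f {i, k} = 0" "g {i, j} + g {j, k} + g {i, k} = 0"
      using * that unfolding cocycles_def by blast+
    then have "(f {i, j} + f {j, k} + f {i, k}) + (g {i, j} + g {j, k} + g {i, k}) = 0"
      by simp
    then show ?thesis by (simp only: ac_simps)
  qed
  with * show "f \<otimes>\<^bsub>cocycle_group G\<^esub> g \<in> carrier (cocycle_group G)"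
    unfolding cocycle_group_def cocycles_def by simp
next
  fix f assume f: "f \<in> carrier (cocycle_group G)"
  have "f \<otimes>\<^bsub>cocycle_group G\<^esub> f = \<one>\<^bsub>cocycle_group G\<^esub>"
    by (simp only: cocycle_group_def monoid.simps bit_add_self)
  with f show "\<exists>y\<in>carrier (cocycle_group G). y \<otimes>\<^bsub>cocycle_group G\<^esub> f = \<one>\<^bsub>cocycle_group G\<^esub>"
    by blast
next
  show "\<one>\<^bsub>cocycle_group G\<^esub> \<in> carrier (cocycle_group G)"
    by (simp add: cocycle_group_def cocycles_def)
qed (simp_all only: cocycle_group_def monoid.simps ac_simps add_0_left)

lemma coboundaries_subset:
  assumes "looped_graph G"
  shows "coboundaries G \<subseteq> cocycles G"
proof
  fix f assume "f \<in> coboundaries G"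
  then obtain d where z: "\<forall>e. e \<notin> edges G \<longrightarrow> f e = 0"
    and d: "\<And>i j. {i, j} \<in> edges G \<Longrightarrow> f {i, j} = d i + d j"
    unfolding coboundaries_def by blast
  have "f {i, i} = 0" if "i \<in> verts G" for i
    using assms that d[of i i] bit_add_self[of "d i"] unfolding looped_graph_def by simp
  moreover have "f {i, j} + f {j, k} + f {i, k} = 0" if "clique G {i, j, k}" for i j k
  proof -
    have "f {i, j} = d i + d j" "f {j, k} = d j + d k" "f {i, k} = d i + d k"
      using that d unfolding clique_def by auto
    then show ?thesis by (cases "d i"; cases "d j"; cases "d k") simp_all
  qed
  ultimately show "f \<in> cocycles G" using z unfolding cocycles_def by blast
qed

lemma normal_coboundaries:
  assumes "looped_graph G"
  shows "coboundaries G \<lhd> cocycle_group G"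
proof -
  interpret comm_group "cocycle_group G" by (rule comm_group_cocycle)
  have add: "(\<lambda>e. f e + g e) \<in> coboundaries G"
    if f: "f \<in> coboundaries G" and g: "g \<in> coboundaries G" for f g
  proof -
    obtain d where d: "\<And>i j. {i, j} \<in> edges G \<Longrightarrow> f {i, j} = d i + d j"
      using f unfolding coboundaries_def by blast
    obtain d' where d': "\<And>i j. {i, j} \<in> edges G \<Longrightarrow> g {i, j} = d' i + d' j"
      using g unfolding coboundaries_def by blast
    have "f {i, j} + g {i, j} = (d i + d' i) + (d j + d' j)" if "{i, j} \<in> edges G" for i j
      by (simp only: d[OF that] d'[OF that] ac_simps)
    then have "\<exists>d. \<forall>i j. {i, j} \<in> edges G \<longrightarrow> f {i, j} + g {i, j} = d i + d j"
      by (intro exI[of _ "\<lambda>i. d i + d' i"] allI impI)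
    with f g show ?thesis unfolding coboundaries_def by simp
  qed
  have inv: "inv\<^bsub>cocycle_group G\<^esub> f = f" if "f \<in> cocycles G" for f
    using that bit_add_self by (intro inv_equality) (auto simp: cocycle_group_def)
  have "subgroup (coboundaries G) (cocycle_group G)"
  proof
    show "coboundaries G \<subseteq> carrier (cocycle_group G)"
      using coboundaries_subset[OF assms] by (simp add: cocycle_group_def)
    show "\<one>\<^bsub>cocycle_group G\<^esub> \<in> coboundaries G"
      unfolding cocycle_group_def coboundaries_def by (auto intro!: exI[of _ "\<lambda>_. 0"])
  next
    fix f g assume "f \<in> coboundaries G" "g \<in> coboundaries G"
    then show "f \<otimes>\<^bsub>cocycle_group G\<^esub> g \<in> coboundaries G"
      using add by (simp add: cocycle_group_def)
  next
    fix f assume "f \<in> coboundaries G"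
    then show "inv\<^bsub>cocycle_group G\<^esub> f \<in> coboundaries G"
      using inv coboundaries_subset[OF assms] by auto
  qed
  then show ?thesis by (rule subgroup_imp_normal)
qed

lemma pullback_add: "pullback G \<phi> (\<lambda>e. f e + g e) = (\<lambda>e. pullback G \<phi> f e + pullback G \<phi> g e)"
  by (auto simp: pullback_def)

lemma pullback_cocycle:
  assumes "looped_graph G" "graph_hom G H \<phi>" "f \<in> cocycles H"
  shows "pullback G \<phi> f \<in> cocycles G"
proof -
  have loop: "f {\<phi> i} = 0" if "i \<in> verts G" for i
    using assms that unfolding graph_hom_def cocycles_def by auto
  have "pullback G \<phi> f {i, j} + pullback G \<phi> f {j, k} + pullback G \<phi> f {i, k} = 0"
    if c: "clique G {i, j, k}" for i j k
  proof -
    have e: "{i, j} \<in> edges G" "{j, k} \<in> edges G" "{i, k} \<in> edges G"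
      and v: "i \<in> verts G" "j \<in> verts G" "k \<in> verts G"
      using c unfolding clique_def by auto
    have "clique H {\<phi> i, \<phi> j, \<phi> k}"
    proof -
      have "{\<phi> a, \<phi> b} \<in> edges H" if "a \<in> {i, j, k}" "b \<in> {i, j, k}" for a b
        using c that assms(2) unfolding clique_def graph_hom_def by blast
      moreover have "\<phi> a \<in> verts H" if "a \<in> {i, j, k}" for a
        using v that assms(2) unfolding graph_hom_def by blast
      moreover have "{\<phi> i, \<phi> j, \<phi> k} = \<phi> ` {i, j, k}" by simp
      ultimately show ?thesis unfolding clique_def by blast
    qed
    moreover have "card {\<phi> i, \<phi> j, \<phi> k} = 3" if "\<phi> i \<noteq> \<phi> j" "\<phi> j \<noteq> \<phi> k" "\<phi> i \<noteq> \<phi> k"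
      using that by simp
    ultimately have "f {\<phi> i, \<phi> j} + f {\<phi> j, \<phi> k} + f {\<phi> i, \<phi> k} = 0"
      if "\<phi> i \<noteq> \<phi> j" "\<phi> j \<noteq> \<phi> k" "\<phi> i \<noteq> \<phi> k"
      using that assms(3) unfolding cocycles_def by blast
    moreover have "f {\<phi> i, \<phi> j} + f {\<phi> j, \<phi> k} + f {\<phi> i, \<phi> k} = 0"
      if "\<phi> i = \<phi> j \<or> \<phi> j = \<phi> k \<or> \<phi> i = \<phi> k"
      using that
    proof (elim disjE)
      assume "\<phi> i = \<phi> j"
      then show ?thesis using loop[OF v(2)] bit_add_self[of "f {\<phi> j, \<phi> k}"] by simp
    next
      assume "\<phi> j = \<phi> k"
      then show ?thesis using loop[OF v(3)] bit_add_self[of "f {\<phi> i, \<phi> k}"] by simp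
    next
      assume "\<phi> i = \<phi> k"
      moreover have "{\<phi> j, \<phi> k} = {\<phi> k, \<phi> j}" by blast
      ultimately show ?thesis
        using loop[OF v(3)] bit_add_self[of "f {\<phi> k, \<phi> j}"] by simp
    qed
    ultimately have "f {\<phi> i, \<phi> j} + f {\<phi> j, \<phi> k} + f {\<phi> i, \<phi> k} = 0"
      by blast
    then show ?thesis using e by (simp add: pullback_def)
  qed
  then show ?thesis
    using loop assms(1) unfolding cocycles_def by (auto simp: pullback_def)
qed

lemma pullback_coboundary:
  assumes "graph_hom G H \<phi>" "f \<in> coboundaries H"
  shows "pullback G \<phi> f \<in> coboundaries G"
proof -
  obtain d where "\<And>i j. {i, j} \<in> edges H \<Longrightarrow> f {i, j} = d i + d j"
    using assms(2) unfolding coboundaries_def by blast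
  then have "\<forall>i j. {i, j} \<in> edges G \<longrightarrow> pullback G \<phi> f {i, j} = d (\<phi> i) + d (\<phi> j)"
    using assms(1) unfolding graph_hom_def pullback_def by simp
  then have "\<exists>d. \<forall>i j. {i, j} \<in> edges G \<longrightarrow> pullback G \<phi> f {i, j} = d i + d j"
    by (intro exI[of _ "d \<circ> \<phi>"]) simp
  then show ?thesis unfolding coboundaries_def by (simp add: pullback_def)
qed

lemma H1_map_coset:
  assumes G: "looped_graph G" and H: "looped_graph H"
    and hom: "graph_hom G H \<phi>" and f: "f \<in> cocycles H"
  shows "H1_map G \<phi> (coboundaries H #>\<^bsub>cocycle_group H\<^esub> f) =
         coboundaries G #>\<^bsub>cocycle_group G\<^esub> pullback G \<phi> f"
proof -
  interpret N: normal "coboundaries G" "cocycle_group G"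
    by (rule normal_coboundaries[OF G])
  interpret M: normal "coboundaries H" "cocycle_group H"
    by (rule normal_coboundaries[OF H])
  have eq: "coboundaries G #>\<^bsub>cocycle_group G\<^esub> pullback G \<phi> g =
      coboundaries G #>\<^bsub>cocycle_group G\<^esub> pullback G \<phi> f"
    if g: "g \<in> coboundaries H #>\<^bsub>cocycle_group H\<^esub> f" for g
  proof -
    obtain b where b: "b \<in> coboundaries H" and "g = (\<lambda>e. b e + f e)"
      using g by (auto simp: r_coset_def cocycle_group_def)
    then have "pullback G \<phi> g = pullback G \<phi> b \<otimes>\<^bsub>cocycle_group G\<^esub> pullback G \<phi> f"
      by (simp only: pullback_add cocycle_group_def monoid.simps)
    with pullback_coboundary[OF hom b]
    have "pullback G \<phi> g \<in> coboundaries G #>\<^bsub>cocycle_group G\<^esub> pullback G \<phi> f"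
      unfolding r_coset_def by blast
    moreover have "pullback G \<phi> f \<in> carrier (cocycle_group G)"
      using pullback_cocycle[OF G hom f] by (simp add: cocycle_group_def)
    ultimately show ?thesis
      using N.repr_independence[OF _ _ N.is_subgroup] by blast
  qed
  have "f \<in> coboundaries H #>\<^bsub>cocycle_group H\<^esub> f"
    using M.rcos_self[OF _ M.is_subgroup] f by (simp add: cocycle_group_def)
  with eq show ?thesis unfolding H1_map_def by blast
qed

end

theory Submission
  imports Defs
begin

text \<open>By the theorem of Minkowski and Krein--Milman, a matrix of trace 1 in \<open>P(G)\<close> is a convex
  combination of matrices spanning extreme rays, so it suffices to shift a locally rank 1 matrix \<open>X\<close>.
  Its entries are \<open>t(\<phi> i, \<phi> j) x\<^sub>i x\<^sub>j\<close> for a sign cocycle \<open>t\<close> of \<open>H\<close>, because the signs of \<open>X\<close> on its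
  support are the pullback of such a \<open>t\<close> up to a coboundary.  Let \<open>y\<^sub>a\<close> be the norm of \<open>x\<close> on the fibre
  of \<open>a\<close>.  The matrix \<open>Y\<close> with entries \<open>t(a, b) y\<^sub>a y\<^sub>b\<close> lies in \<open>P(H)\<close> and has trace 1, and a
  completion \<open>M\<close> of \<open>Y + \<epsilon> I\<close> pulls back to the matrix with entries \<open>u\<^sub>i u\<^sub>j M(\<phi> i, \<phi> j)\<close>, where
  \<open>u\<^sub>i = x\<^sub>i / y(\<phi> i)\<close>.  This completes \<open>X + \<epsilon> B\<close>, and \<open>0 \<le> B \<le> I\<close> as \<open>u\<close> has norm at most 1 on each
  fibre.  Passing from \<open>B\<close> to \<open>I\<close> needs a nonnegative shift.  This is available when \<open>H\<close> has two
  vertices, and unnecessary when \<open>G\<close> has only one, as then \<open>B = I\<close>.\<close>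

section \<open>Positive semidefinite principal submatrices\<close>

text \<open>Reduces the padded matrix to a quadratic form over \<open>C\<close> with arbitrary test
  functions, the form in which positive semidefiniteness is handled from here on.\<close>

lemma psd_principal_iff:
  fixes A :: "real^'n::finite^'n"
  shows "psd (principal_submatrix C A) \<longleftrightarrow>
    (\<forall>i\<in>C. \<forall>j\<in>C. A $ i $ j = A $ j $ i) \<and>
    (\<forall>f. 0 \<le> (\<Sum>i\<in>C. \<Sum>j\<in>C. f i * A $ i $ j * f j))"
proof -
  have form: "v \<bullet> (principal_submatrix C A *v v) =
      (\<Sum>i\<in>C. \<Sum>j\<in>C. v $ i * A $ i $ j * v $ j)" for v
  proof -
    have "v \<bullet> (principal_submatrix C A *v v) =
        (\<Sum>i\<in>UNIV. \<Sum>j\<in>UNIV. if i \<in> C \<and> j \<in> C then v $ i * A $ i $ j * v $ j else 0)"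
      by (auto simp: inner_vec_def matrix_vector_mult_def principal_submatrix_def
          sum_distrib_left intro!: sum.cong)
    also have "\<dots> = (\<Sum>i\<in>C. \<Sum>j\<in>C. v $ i * A $ i $ j * v $ j)"
      by (intro sum.mono_neutral_cong_right) (auto intro!: sum.mono_neutral_cong_right)
    finally show ?thesis .
  qed
  have "transpose (principal_submatrix C A) = principal_submatrix C A \<longleftrightarrow>
      (\<forall>i\<in>C. \<forall>j\<in>C. A $ i $ j = A $ j $ i)"
    by (auto simp: vec_eq_iff transpose_def principal_submatrix_def)
  moreover have "(\<forall>v. 0 \<le> v \<bullet> (principal_submatrix C A *v v)) \<longleftrightarrow>
      (\<forall>f. 0 \<le> (\<Sum>i\<in>C. \<Sum>j\<in>C. f i * A $ i $ j * f j))"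
  proof
    assume l: "\<forall>v. 0 \<le> v \<bullet> (principal_submatrix C A *v v)"
    show "\<forall>f. 0 \<le> (\<Sum>i\<in>C. \<Sum>j\<in>C. f i * A $ i $ j * f j)"
    proof
      fix f
      show "0 \<le> (\<Sum>i\<in>C. \<Sum>j\<in>C. f i * A $ i $ j * f j)"
        using l[rule_format, of "\<chi> i. f i"] by (simp add: form)
    qed
  qed (auto simp: form)
  ultimately show ?thesis by (simp add: psd_def)
qed

lemma psd_principal_mono:
  fixes A :: "real^'n::finite^'n"
  assumes "psd (principal_submatrix D A)" "C \<subseteq> D"
  shows "psd (principal_submatrix C A)"
proof -
  have "0 \<le> (\<Sum>i\<in>C. \<Sum>j\<in>C. f i * A $ i $ j * f j)" for f
  proof -
    let ?g = "\<lambda>i. if i \<in> C then f i else 0"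
    have "(\<Sum>i\<in>D. \<Sum>j\<in>D. ?g i * A $ i $ j * ?g j) = (\<Sum>i\<in>C. \<Sum>j\<in>C. f i * A $ i $ j * f j)"
      using assms(2)
      by (intro sum.mono_neutral_cong_right) (auto intro!: sum.mono_neutral_cong_right)
    moreover have "0 \<le> (\<Sum>i\<in>D. \<Sum>j\<in>D. ?g i * A $ i $ j * ?g j)"
      using conjunct2[OF assms(1)[unfolded psd_principal_iff]] by (rule allE)
    ultimately show ?thesis by simp
  qed
  then show ?thesis
    using assms unfolding psd_principal_iff by blast
qed

lemma psd_principal_cong:
  assumes "\<And>i j. i \<in> C \<Longrightarrow> j \<in> C \<Longrightarrow> A $ i $ j = B $ i $ j"
  shows "psd (principal_submatrix C A) \<longleftrightarrow> psd (principal_submatrix C B)"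
proof -
  have "principal_submatrix C A = principal_submatrix C B"
    using assms by (simp add: principal_submatrix_def vec_eq_iff)
  then show ?thesis by simp
qed

lemma psd_diag_nonneg:
  fixes A :: "real^'n::finite^'n"
  assumes "psd (principal_submatrix C A)" "i \<in> C"
  shows "0 \<le> A $ i $ i"
proof -
  have "psd (principal_submatrix {i} A)"
    by (rule psd_principal_mono[OF assms(1)]) (use assms(2) in simp)
  then show ?thesis
    unfolding psd_principal_iff by (auto dest: spec[of _ "\<lambda>_. 1"])
qed

lemma psd_entry_bound:
  fixes A :: "real^'n::finite^'n"
  assumes "psd (principal_submatrix C A)" "i \<in> C" "j \<in> C"
  shows "2 * \<bar>A $ i $ j\<bar> \<le> A $ i $ i + A $ j $ j"
proof (cases "i = j")
  case True
  then show ?thesis using psd_diag_nonneg[OF assms(1,2)] by simp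
next
  case False
  have p: "psd (principal_submatrix {i, j} A)"
    by (rule psd_principal_mono[OF assms(1)]) (use assms(2,3) in simp)
  then have s: "A $ i $ j = A $ j $ i"
    unfolding psd_principal_iff by blast
  have "0 \<le> (\<Sum>k\<in>{i, j}. \<Sum>l\<in>{i, j}. f k * A $ k $ l * f l)" for f
    using p unfolding psd_principal_iff by blast
  \<comment> \<open>The test vectors (1, 1) and (1, -1) bound the entry from below and from
    above.\<close>
  from this[of "\<lambda>_. 1"] this[of "\<lambda>k. if k = i then 1 else -1"] False s
  show ?thesis by simp
qed

lemma psd_principal_add:
  fixes A B :: "real^'n::finite^'n"
  assumes "psd (principal_submatrix C A)" "psd (principal_submatrix C B)"
  shows "psd (principal_submatrix C (A + B))"
proof -
  have "(\<Sum>i\<in>C. \<Sum>j\<in>C. f i * (A + B) $ i $ j * f j) =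
      (\<Sum>i\<in>C. \<Sum>j\<in>C. f i * A $ i $ j * f j) + (\<Sum>i\<in>C. \<Sum>j\<in>C. f i * B $ i $ j * f j)" for f
    by (simp add: algebra_simps sum.distrib)
  then show ?thesis
    using assms unfolding psd_principal_iff by simp
qed

lemma psd_principal_scaleR:
  fixes A :: "real^'n::finite^'n"
  assumes "psd (principal_submatrix C A)" "0 \<le> c"
  shows "psd (principal_submatrix C (c *\<^sub>R A))"
proof -
  have "(\<Sum>i\<in>C. \<Sum>j\<in>C. f i * (c *\<^sub>R A) $ i $ j * f j) =
      c * (\<Sum>i\<in>C. \<Sum>j\<in>C. f i * A $ i $ j * f j)" for f
    by (simp add: sum_distrib_left algebra_simps)
  then show ?thesis
    using assms unfolding psd_principal_iff by simp
qed

section \<open>Closedness and norm bounds for the compactness arguments\<close>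

lemma closed_psd_principal: "closed {A :: real^'n::finite^'n. psd (principal_submatrix C A)}"
  unfolding psd_principal_iff Ball_def
  by (intro closed_Collect_conj closed_Collect_all closed_Collect_imp closed_Collect_eq
      closed_Collect_le open_Collect_const continuous_intros)

lemma norm_matrix_le:
  fixes A :: "real^'n::finite^'m::finite"
  shows "norm A \<le> (\<Sum>i\<in>UNIV. \<Sum>j\<in>UNIV. \<bar>A $ i $ j\<bar>)"
proof -
  have "norm A \<le> (\<Sum>i\<in>UNIV. norm (A $ i))"
    unfolding norm_vec_def by (intro L2_set_le_sum) simp
  also have "\<dots> \<le> (\<Sum>i\<in>UNIV. \<Sum>j\<in>UNIV. \<bar>A $ i $ j\<bar>)"
    by (intro sum_mono norm_le_l1_cart)
  finally show ?thesis .
qed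

lemma entry_le_sum_abs:
  fixes A :: "real^'n::finite^'m::finite"
  shows "\<bar>A $ i $ j\<bar> \<le> (\<Sum>i\<in>UNIV. \<Sum>j\<in>UNIV. \<bar>A $ i $ j\<bar>)"
proof -
  have "\<bar>A $ i $ j\<bar> \<le> (\<Sum>j\<in>UNIV. \<bar>A $ i $ j\<bar>)"
    by (rule member_le_sum) auto
  also have "\<dots> \<le> (\<Sum>i\<in>UNIV. \<Sum>j\<in>UNIV. \<bar>A $ i $ j\<bar>)"
    by (rule member_le_sum[where f = "\<lambda>i. \<Sum>j\<in>UNIV. \<bar>A $ i $ j\<bar>"]) (auto intro: sum_nonneg)
  finally show ?thesis .
qed


section \<open>The cones of partial matrices\<close>

lemma looped_edgeD:
  assumes "looped_graph G" "{i, j} \<in> edges G"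
  shows "i \<in> verts G" "j \<in> verts G"
proof -
  obtain k l where "{i, j} = {k, l}" "k \<in> verts G" "l \<in> verts G"
    using assms unfolding looped_graph_def by blast
  then show "i \<in> verts G" "j \<in> verts G" by (metis doubleton_eq_iff)+
qed

lemma looped_loop:
  assumes "looped_graph G"
  shows "{i} \<in> edges G \<longleftrightarrow> i \<in> verts G"
proof
  show "i \<in> verts G" if "{i} \<in> edges G"
    using looped_edgeD(1)[OF assms, of i i] that by simp
  show "{i} \<in> edges G" if "i \<in> verts G"
    using assms that unfolding looped_graph_def by simp
qed

lemma looped_clique_edge:
  assumes "looped_graph G" "{i, j} \<in> edges G"
  shows "clique G {i, j}"
  using looped_edgeD[OF assms] looped_loop[OF assms(1)] assms(2)
  by (simp add: clique_def insert_commute)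

lemma partial_id_nth: "partial_id G $ i $ j = (if i \<in> verts G \<and> i = j then 1 else 0)"
  by (auto simp: partial_id_def principal_submatrix_def mat_def)

lemma partial_id_Sym:
  assumes "looped_graph G"
  shows "partial_id G \<in> Sym G"
  using looped_loop[OF assms] by (auto simp: Sym_def vec_eq_iff transpose_def partial_id_nth)

lemma Sym_nth_commute: "X \<in> Sym G \<Longrightarrow> X $ i $ j = X $ j $ i"
  by (auto simp: Sym_def vec_eq_iff transpose_def)

lemma Sym_nth_zero: "X \<in> Sym G \<Longrightarrow> {i, j} \<notin> edges G \<Longrightarrow> X $ i $ j = 0"
  by (auto simp: Sym_def)

lemma subspace_Sym: "subspace (Sym G)"
  by (auto simp: subspace_def Sym_def vec_eq_iff transpose_def)

lemmas Sym_add = subspace_add[OF subspace_Sym]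
lemmas Sym_scaleR = subspace_scale[OF subspace_Sym]
lemmas Sym_diff = subspace_diff[OF subspace_Sym]

lemma Sym_shift:
  assumes "looped_graph G" "X \<in> Sym G"
  shows "X + c *\<^sub>R partial_id G \<in> Sym G"
  by (intro Sym_add assms Sym_scaleR partial_id_Sym)

lemma psd_completable_add:
  assumes "X \<in> psd_completable G" "Y \<in> psd_completable G"
  shows "X + Y \<in> psd_completable G"
proof -
  obtain A B where "\<forall>i j. {i, j} \<in> edges G \<longrightarrow> A $ i $ j = X $ i $ j"
    "\<forall>i j. {i, j} \<in> edges G \<longrightarrow> B $ i $ j = Y $ i $ j"
    "psd (principal_submatrix (verts G) A)" "psd (principal_submatrix (verts G) B)"
    using assms unfolding psd_completable_def by blast
  then have "\<forall>i j. {i, j} \<in> edges G \<longrightarrow> (A + B) $ i $ j = (X + Y) $ i $ j"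
    "psd (principal_submatrix (verts G) (A + B))"
    by (simp_all add: psd_principal_add)
  then show ?thesis
    using assms Sym_add unfolding psd_completable_def by blast
qed

lemma psd_completable_scaleR:
  assumes "X \<in> psd_completable G" "0 \<le> c"
  shows "c *\<^sub>R X \<in> psd_completable G"
proof -
  obtain A where "\<forall>i j. {i, j} \<in> edges G \<longrightarrow> A $ i $ j = X $ i $ j"
    "psd (principal_submatrix (verts G) A)"
    using assms unfolding psd_completable_def by blast
  then have "\<forall>i j. {i, j} \<in> edges G \<longrightarrow> (c *\<^sub>R A) $ i $ j = (c *\<^sub>R X) $ i $ j"
    "psd (principal_submatrix (verts G) (c *\<^sub>R A))"
    using assms by (simp_all add: psd_principal_scaleR)
  then show ?thesis
    using assms Sym_scaleR unfolding psd_completable_def by blast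
qed

lemma convex_psd_completable: "convex (psd_completable G)"
  unfolding convex_def by (blast intro: psd_completable_add psd_completable_scaleR)

lemma psd_completable_diag:
  assumes "looped_graph G" "X \<in> psd_completable G" "i \<in> verts G"
  shows "0 \<le> X $ i $ i"
proof -
  obtain A where A: "\<forall>i j. {i, j} \<in> edges G \<longrightarrow> A $ i $ j = X $ i $ j"
    "psd (principal_submatrix (verts G) A)"
    using assms unfolding psd_completable_def by blast
  then have "A $ i $ i = X $ i $ i" using looped_loop[OF assms(1)] assms(3) by simp
  with psd_diag_nonneg[OF A(2) assms(3)] show ?thesis by simp
qed

text \<open>Filling the unspecified entries with 0 is enough, because the sum of the absolute
  entries of \<open>X\<close> bounds its quadratic form in terms of the squared norm of the test
  function. The crude constant serves twice: it shows that some shift is feasible, and it makes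
  \<open>eps_matrix\<close> Lipschitz.\<close>

lemma psd_completable_shift:
  fixes X :: "real^'n::finite^'n"
  assumes "looped_graph G" "X \<in> Sym G" "(\<Sum>i\<in>UNIV. \<Sum>j\<in>UNIV. \<bar>X $ i $ j\<bar>) \<le> c"
  shows "X + c *\<^sub>R partial_id G \<in> psd_completable G"
proof -
  let ?Z = "X + c *\<^sub>R partial_id G"
  let ?s = "\<Sum>i\<in>UNIV. \<Sum>j\<in>UNIV. \<bar>X $ i $ j\<bar>"
  let ?V = "verts G"
  have Z: "?Z \<in> Sym G" by (rule Sym_shift[OF assms(1,2)])
  have "0 \<le> (\<Sum>i\<in>?V. \<Sum>j\<in>?V. f i * ?Z $ i $ j * f j)" for f
  proof -
    let ?q = "\<Sum>i\<in>?V. (f i)\<^sup>2"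
    have fq: "(f i)\<^sup>2 \<le> ?q" if "i \<in> ?V" for i
      by (rule member_le_sum[OF that]) auto
    have q0: "0 \<le> ?q" by (intro sum_nonneg) auto
    have "- (\<Sum>i\<in>?V. \<Sum>j\<in>?V. f i * X $ i $ j * f j) \<le> (\<Sum>i\<in>?V. \<Sum>j\<in>?V. \<bar>X $ i $ j\<bar> * ?q)"
      unfolding sum_negf[symmetric]
    proof (intro sum_mono)
      fix i j assume i: "i \<in> ?V" "j \<in> ?V"
      have "\<bar>f i * f j\<bar> \<le> ((f i)\<^sup>2 + (f j)\<^sup>2) / 2"
        using sum_squares_bound[of "\<bar>f i\<bar>" "\<bar>f j\<bar>"] by (simp add: abs_mult)
      then have "\<bar>f i * f j\<bar> \<le> ?q" using fq[OF i(1)] fq[OF i(2)] by simp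
      then have "\<bar>X $ i $ j\<bar> * \<bar>f i * f j\<bar> \<le> \<bar>X $ i $ j\<bar> * ?q"
        by (rule mult_left_mono) simp
      moreover have "- (f i * X $ i $ j * f j) \<le> \<bar>X $ i $ j\<bar> * \<bar>f i * f j\<bar>"
        by (simp add: abs_mult[symmetric] mult.commute mult.left_commute)
      ultimately show "- (f i * X $ i $ j * f j) \<le> \<bar>X $ i $ j\<bar> * ?q" by linarith
    qed
    also have "\<dots> = (\<Sum>i\<in>?V. \<Sum>j\<in>?V. \<bar>X $ i $ j\<bar>) * ?q"
      by (simp add: sum_distrib_right)
    also have "\<dots> \<le> ?s * ?q"
    proof (intro mult_right_mono q0)
      have "(\<Sum>i\<in>?V. \<Sum>j\<in>?V. \<bar>X $ i $ j\<bar>) \<le> (\<Sum>i\<in>?V. \<Sum>j\<in>UNIV. \<bar>X $ i $ j\<bar>)"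
        by (intro sum_mono sum_mono2) auto
      also have "\<dots> \<le> ?s" by (intro sum_mono2) (auto intro: sum_nonneg)
      finally show "(\<Sum>i\<in>?V. \<Sum>j\<in>?V. \<bar>X $ i $ j\<bar>) \<le> ?s" .
    qed
    also have "\<dots> \<le> c * ?q" by (intro mult_right_mono q0 assms(3))
    finally have "- (\<Sum>i\<in>?V. \<Sum>j\<in>?V. f i * X $ i $ j * f j) \<le> c * ?q" .
    moreover have "(\<Sum>i\<in>?V. \<Sum>j\<in>?V. f i * ?Z $ i $ j * f j) =
        (\<Sum>i\<in>?V. \<Sum>j\<in>?V. f i * X $ i $ j * f j) + (\<Sum>i\<in>?V. \<Sum>j\<in>?V. if i = j then c * (f i)\<^sup>2 else 0)"
      unfolding sum.distrib[symmetric]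
      by (intro sum.cong) (auto simp: partial_id_nth algebra_simps power2_eq_square)
    moreover have "(\<Sum>i\<in>?V. \<Sum>j\<in>?V. if i = j then c * (f i)\<^sup>2 else 0) = c * ?q"
      by (simp add: sum_distrib_left)
    ultimately show ?thesis by linarith
  qed
  then have "psd (principal_submatrix ?V ?Z)"
    unfolding psd_principal_iff using Sym_nth_commute[OF Z] by blast
  then show ?thesis
    using Z unfolding psd_completable_def by blast
qed

section \<open>Entry bounds in the cone \<open>locally_psd G\<close>\<close>

lemma locally_psd_Sym: "X \<in> locally_psd G \<Longrightarrow> X \<in> Sym G"
  by (simp add: locally_psd_def)

lemma locally_psd_diag:
  assumes "looped_graph G" "X \<in> locally_psd G"
  shows "0 \<le> X $ i $ i"
proof (cases "i \<in> verts G")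
  case True
  then have "clique G {i}"
    using looped_loop[OF assms(1)] by (simp add: clique_def)
  then show ?thesis
    using assms(2) psd_diag_nonneg[of "{i}" X i] by (auto simp: locally_psd_def)
next
  case False
  then show ?thesis
    using Sym_nth_zero[OF locally_psd_Sym[OF assms(2)], of i i] looped_loop[OF assms(1)] by simp
qed

lemma locally_psd_entry:
  assumes "looped_graph G" "X \<in> locally_psd G"
  shows "2 * \<bar>X $ i $ j\<bar> \<le> X $ i $ i + X $ j $ j"
proof (cases "{i, j} \<in> edges G")
  case True
  then have "psd (principal_submatrix {i, j} X)"
    using looped_clique_edge[OF assms(1)] assms(2) by (auto simp: locally_psd_def)
  then show ?thesis by (rule psd_entry_bound) auto
next
  case False
  then show ?thesis
    using Sym_nth_zero[OF locally_psd_Sym[OF assms(2)] False]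
      locally_psd_diag[OF assms, of i] locally_psd_diag[OF assms, of j] by simp
qed

text \<open>Each entry is at most the mean of two diagonal entries, and these are nonnegative
  summands of the trace. Hence trace 0 forces the zero matrix, and the slice of trace 1 is
  bounded.\<close>

lemma locally_psd_entry_trace:
  assumes "looped_graph G" "X \<in> locally_psd G"
  shows "\<bar>X $ i $ j\<bar> \<le> trace X"
proof -
  have "X $ k $ k \<le> trace X" for k
    unfolding trace_def using locally_psd_diag[OF assms]
    by (intro member_le_sum[where f = "\<lambda>k. X $ k $ k"]) auto
  from this[of i] this[of j] locally_psd_entry[OF assms, of i j] show ?thesis by linarith
qed

lemma locally_psd_trace_zero:
  assumes "looped_graph G" "X \<in> locally_psd G" "trace X = 0"
  shows "X = 0"
proof -
  have "X $ i $ j = 0" for i j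
    using locally_psd_entry_trace[OF assms(1,2), of i j] assms(3) by simp
  then show ?thesis by (simp add: vec_eq_iff)
qed

lemma locally_psd_trace_nonneg:
  assumes "looped_graph G" "X \<in> locally_psd G"
  shows "0 \<le> trace X"
  unfolding trace_def using locally_psd_diag[OF assms] by (simp add: sum_nonneg)

lemma locally_psd_add:
  "X \<in> locally_psd G \<Longrightarrow> Y \<in> locally_psd G \<Longrightarrow> X + Y \<in> locally_psd G"
  by (simp add: locally_psd_def Sym_add psd_principal_add)

lemma locally_psd_scaleR:
  "X \<in> locally_psd G \<Longrightarrow> 0 \<le> c \<Longrightarrow> c *\<^sub>R X \<in> locally_psd G"
  by (simp add: locally_psd_def Sym_scaleR psd_principal_scaleR)

section \<open>The slice of trace 1 and its extreme points\<close>

lemma trace_scaleR: "trace (c *\<^sub>R (A::real^'n::finite^'n)) = c * trace A"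
  by (simp add: trace_def sum_distrib_left)

definition locally_psd_base :: "'n::finite graph \<Rightarrow> (real^'n^'n) set" where
  "locally_psd_base G = {X \<in> locally_psd G. trace X = 1}"

lemma convex_locally_psd_base: "convex (locally_psd_base G)"
  unfolding convex_def locally_psd_base_def
  by (auto simp: locally_psd_add locally_psd_scaleR trace_add trace_scaleR)

lemma compact_locally_psd_base:
  assumes "looped_graph G"
  shows "compact (locally_psd_base G)"
proof -
  have "closed (locally_psd_base G)"
  proof -
    have "locally_psd_base G = Sym G \<inter> {X. \<forall>C. clique G C \<longrightarrow> psd (principal_submatrix C X)}
        \<inter> {X. (\<Sum>i\<in>UNIV. X $ i $ i) = 1}"
      by (auto simp: locally_psd_base_def locally_psd_def trace_def)
    moreover have "closed (Sym G)" by (rule closed_subspace[OF subspace_Sym])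
    moreover have "closed {X. \<forall>C. clique G C \<longrightarrow> psd (principal_submatrix C X)}"
      by (intro closed_Collect_all closed_Collect_imp open_Collect_const closed_psd_principal)
    moreover have "closed {X :: real^'a^'a. (\<Sum>i\<in>UNIV. X $ i $ i) = 1}"
      by (intro closed_Collect_eq continuous_intros)
    ultimately show ?thesis by (simp add: closed_Int)
  qed
  moreover have "norm X \<le> (\<Sum>i\<in>(UNIV::'a set). \<Sum>j\<in>(UNIV::'a set). 1)"
    if "X \<in> locally_psd_base G" for X
  proof (rule order_trans[OF norm_matrix_le sum_mono[OF sum_mono]])
    show "\<bar>X $ i $ j\<bar> \<le> 1" for i j
      using that locally_psd_entry_trace[OF assms, of X i j] by (simp add: locally_psd_base_def)
  qed
  then have "bounded (locally_psd_base G)" unfolding bounded_iff by blast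
  ultimately show ?thesis by (simp add: compact_eq_bounded_closed)
qed

lemma scaleR_eq_imp_divide:
  fixes x y :: "'v::real_vector"
  assumes "u \<noteq> 0" "u *\<^sub>R y = c *\<^sub>R x"
  shows "y = (c / u) *\<^sub>R x"
proof -
  have "y = (1 / u) *\<^sub>R (u *\<^sub>R y)" using assms(1) by simp
  also have "\<dots> = (1 / u) *\<^sub>R (c *\<^sub>R x)" by (simp only: assms(2))
  finally show ?thesis by simp
qed

text \<open>A segment in the cone that meets the ray in its interior is rescaled so that both
  endpoints have trace 1; extremality of \<open>x\<close> in the base then makes them equal to
  \<open>x\<close>. An endpoint of trace 0 cannot be rescaled, but it is the zero matrix, and then
  the other endpoint is a multiple of \<open>x\<close>.\<close>

lemma extreme_ray_of_base:
  assumes G: "looped_graph G" and x: "x extreme_point_of locally_psd_base G"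
  shows "extreme_ray_of (conic hull {x}) (locally_psd G)"
proof -
  have xK: "x \<in> locally_psd G" "trace x = 1"
    using x by (auto simp: extreme_point_of_def locally_psd_base_def)
  have ray: "conic hull {x} = {c *\<^sub>R x |c. 0 \<le> c}"
    by (auto simp: conic_hull_explicit)
  have "a \<in> conic hull {x} \<and> b \<in> conic hull {x}"
    if ab: "a \<in> locally_psd G" "b \<in> locally_psd G" and z: "z \<in> conic hull {x}" "z \<in> open_segment a b"
    for a b z
  proof -
    obtain c where c: "0 \<le> c" "z = c *\<^sub>R x" using z(1) ray by auto
    obtain u where u: "0 < u" "u < 1" "z = (1 - u) *\<^sub>R a + u *\<^sub>R b" and ne: "a \<noteq> b"
      using z(2) by (auto simp: in_segment)
    have tr: "c = (1 - u) * trace a + u * trace b"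
      using arg_cong[OF c(2)[symmetric], of trace] xK(2) by (simp add: u(3) trace_add trace_scaleR)
    have ta: "0 \<le> trace a" "0 \<le> trace b"
      using locally_psd_trace_nonneg[OF G] ab by auto
    consider "trace a = 0" | "trace b = 0" | "0 < trace a" "0 < trace b" using ta by linarith
    then show ?thesis
    proof cases
      case 1
      then have a: "a = 0" using locally_psd_trace_zero[OF G ab(1)] by simp
      then have "u *\<^sub>R b = c *\<^sub>R x" using u(3) c(2) by simp
      then have "b = (c / u) *\<^sub>R x"
        using scaleR_eq_imp_divide[of u] u(1) by force
      moreover have "0 \<le> c / u" using c(1) u(1) by simp
      moreover have "a = 0 *\<^sub>R x" using a by simp
      ultimately show ?thesis unfolding ray by blast
    next
      case 2
      then have b: "b = 0" using locally_psd_trace_zero[OF G ab(2)] by simp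
      then have "(1 - u) *\<^sub>R a = c *\<^sub>R x" using u(3) c(2) by simp
      then have "a = (c / (1 - u)) *\<^sub>R x"
        using scaleR_eq_imp_divide[of "1 - u"] u(2) by force
      moreover have "0 \<le> c / (1 - u)" using c(1) u(2) by simp
      moreover have "b = 0 *\<^sub>R x" using b by simp
      ultimately show ?thesis unfolding ray by blast
    next
      case 3
      define a' where "a' = (1 / trace a) *\<^sub>R a"
      define b' where "b' = (1 / trace b) *\<^sub>R b"
      have a': "a = trace a *\<^sub>R a'" "b = trace b *\<^sub>R b'" using 3 by (simp_all add: a'_def b'_def)
      have K: "a' \<in> locally_psd_base G" "b' \<in> locally_psd_base G"
        using 3 ab by (simp_all add: a'_def b'_def locally_psd_base_def locally_psd_scaleR trace_scaleR)
      have cpos: "0 < c" using tr 3 u by (simp add: add_pos_pos)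
      \<comment> \<open>The weight of \<open>b'\<close> once \<open>z\<close> is divided by its
        trace \<open>c\<close>. By \<open>tr\<close> the complementary weight is that of
        \<open>a'\<close>, so \<open>x\<close> is a convex combination of points of the
        base.\<close>
      define w where "w = u * trace b / c"
      have w: "0 < w" "1 - w = (1 - u) * trace a / c" using cpos 3 u tr
        by (simp_all add: w_def field_simps)
      then have "0 < 1 - w" using cpos 3 u by simp
      have "x = (1 / c) *\<^sub>R z" using c cpos by simp
      also have "\<dots> = (1 - w) *\<^sub>R a' + w *\<^sub>R b'"
        unfolding w(2) u(3) by (subst (1) a'(1), subst (1) a'(2)) (simp add: w_def algebra_simps diff_divide_distrib)
      finally have xw: "x = (1 - w) *\<^sub>R a' + w *\<^sub>R b'" .
      have "a' = b'"
      proof (rule ccontr)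
        assume "a' \<noteq> b'"
        with xw w(1) \<open>0 < 1 - w\<close> have "x \<in> open_segment a' b'" by (auto simp: in_segment)
        with x K show False by (auto simp: extreme_point_of_def)
      qed
      with xw have "a' = x" "b' = x" by (simp_all add: algebra_simps)
      with a' ta show ?thesis unfolding ray by blast
    qed
  qed
  moreover have "conic hull {x} \<subseteq> locally_psd G"
    unfolding ray using locally_psd_scaleR[OF xK(1)] by auto
  moreover have "convex (conic hull {x})" by (simp add: convex_conic_hull)
  moreover have "x \<noteq> 0" using xK(2) by (auto simp: trace_def)
  ultimately show ?thesis unfolding extreme_ray_of_def face_of_def by blast
qed

section \<open>Attainment of the minimum and the maximum\<close>

text \<open>The first coordinate is minimised over pairs of a shift and a completion. The feasible
  shifts are unbounded above, so they are cut off at \<open>c\<close>, which is itself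
  feasible.\<close>

lemma eps_matrix_least_exists:
  assumes G: "looped_graph G" "verts G \<noteq> {}" and X: "X \<in> Sym G"
  shows "\<exists>\<epsilon>0. X + \<epsilon>0 *\<^sub>R partial_id G \<in> psd_completable G \<and>
    (\<forall>\<epsilon>. X + \<epsilon> *\<^sub>R partial_id G \<in> psd_completable G \<longrightarrow> \<epsilon>0 \<le> \<epsilon>)"
proof -
  define c where "c = (\<Sum>i\<in>UNIV. \<Sum>j\<in>UNIV. \<bar>X $ i $ j\<bar>)"
  have Xc: "\<bar>X $ i $ j\<bar> \<le> c" for i j unfolding c_def by (rule entry_le_sum_abs)
  define agrees where "agrees p \<longleftrightarrow> (\<forall>i j. {i, j} \<in> edges G \<longrightarrow>
      snd p $ i $ j = X $ i $ j + fst p * partial_id G $ i $ j)" for p :: "real \<times> (real^'a^'a)"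
  \<comment> \<open>The cap on the shift and the zeros outside \<open>verts G\<close> make this set
    bounded without losing a minimiser: a completion can always be padded with zeros.\<close>
  define Q where "Q = {p :: real \<times> (real^'a^'a). fst p \<le> c \<and> agrees p \<and>
      (\<forall>i j. i \<notin> verts G \<or> j \<notin> verts G \<longrightarrow> snd p $ i $ j = 0) \<and>
      psd (principal_submatrix (verts G) (snd p))}"
  have completable: "X + fst p *\<^sub>R partial_id G \<in> psd_completable G" if "p \<in> Q" for p
    using that Sym_shift[OF G(1) X] unfolding Q_def agrees_def psd_completable_def by auto
  have Q_witness: "\<exists>p\<in>Q. fst p = \<epsilon>"
    if e: "X + \<epsilon> *\<^sub>R partial_id G \<in> psd_completable G" "\<epsilon> \<le> c" for \<epsilon>
  proof -
    obtain Y where Y: "\<And>i j. {i, j} \<in> edges G \<Longrightarrow>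
        Y $ i $ j = (X + \<epsilon> *\<^sub>R partial_id G) $ i $ j"
      "psd (principal_submatrix (verts G) Y)"
      using e unfolding psd_completable_def by blast
    define Z where "Z = principal_submatrix (verts G) Y"
    have Z: "Z $ i $ j = (if i \<in> verts G \<and> j \<in> verts G then Y $ i $ j else 0)" for i j
      by (simp add: Z_def principal_submatrix_def)
    have "psd (principal_submatrix (verts G) Z)"
      using Y(2) psd_principal_cong[of "verts G" Z Y] Z by simp
    then have "(\<epsilon>, Z) \<in> Q"
      using e(2) Y(1) looped_edgeD[OF G(1)] unfolding Q_def agrees_def by (auto simp: Z)
    then show ?thesis by force
  qed
  have "closed Q"
    unfolding Q_def agrees_def psd_principal_iff Ball_def
    by (intro closed_Collect_conj closed_Collect_all closed_Collect_imp closed_Collect_eq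
        closed_Collect_le open_Collect_const continuous_intros)
  moreover have "bounded Q"
  proof -
    let ?r = "\<Sum>i\<in>(UNIV::'a set). \<Sum>j\<in>(UNIV::'a set). 2 * c"
    have "p \<in> {-c..c} \<times> cball 0 ?r" if p: "p \<in> Q" for p
    proof -
      have diag: "snd p $ i $ i = X $ i $ i + fst p" if "i \<in> verts G" for i
        using p that looped_loop[OF G(1)] unfolding Q_def agrees_def by (simp add: partial_id_nth)
      have psd: "psd (principal_submatrix (verts G) (snd p))" and pc: "fst p \<le> c"
        using p by (auto simp: Q_def)
      have diag_le: "snd p $ i $ i \<le> 2 * c" if "i \<in> verts G" for i
        using diag[OF that] Xc[of i i] pc by linarith
      \<comment> \<open>The lower bound on the shift comes from one vertex: the diagonal entry
        \<open>X $ i0 $ i0 + fst p\<close> of a completion is nonnegative.\<close>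
      obtain i0 where i0: "i0 \<in> verts G" using G(2) by blast
      have "- c \<le> fst p"
        using psd_diag_nonneg[OF psd i0] diag[OF i0] Xc[of i0 i0] by linarith
      moreover have "norm (snd p) \<le> ?r"
      proof (rule order_trans[OF norm_matrix_le sum_mono[OF sum_mono]])
        fix i j
        show "\<bar>snd p $ i $ j\<bar> \<le> 2 * c"
        proof (cases "i \<in> verts G \<and> j \<in> verts G")
          case True
          then show ?thesis
            using psd_entry_bound[OF psd, of i j] diag_le[of i] diag_le[of j] by linarith
        next
          case False
          then have "snd p $ i $ j = 0" using p by (auto simp: Q_def)
          then show ?thesis using Xc[of i j] by linarith
        qed
      qed
      ultimately show ?thesis using pc by (auto simp: mem_Times_iff)
    qed
    then have "Q \<subseteq> {-c..c} \<times> cball 0 ?r" by blast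
    moreover have "bounded ({-c..c} \<times> (cball 0 ?r :: (real^'a^'a) set))"
      by (simp add: bounded_Times)
    ultimately show ?thesis by (rule bounded_subset[rotated])
  qed
  ultimately have "compact Q" by (simp add: compact_eq_bounded_closed)
  moreover have cc: "X + c *\<^sub>R partial_id G \<in> psd_completable G"
    by (rule psd_completable_shift[OF G(1) X]) (simp add: c_def)
  then have "Q \<noteq> {}" using Q_witness by blast
  moreover have "continuous_on Q fst" by (intro continuous_intros)
  ultimately obtain p where p: "p \<in> Q" "\<And>q. q \<in> Q \<Longrightarrow> fst p \<le> fst q"
    using continuous_attains_inf[of Q fst] by blast
  have "fst p \<le> \<epsilon>" if e: "X + \<epsilon> *\<^sub>R partial_id G \<in> psd_completable G" for \<epsilon>
  proof (cases "\<epsilon> \<le> c")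
    case True
    then show ?thesis using Q_witness[OF e] p(2) by blast
  next
    case False
    moreover have "fst p \<le> c" using p(1) by (simp add: Q_def)
    ultimately show ?thesis by linarith
  qed
  with completable[OF p(1)] show ?thesis by blast
qed

lemma eps_matrix_attained:
  assumes "looped_graph G" "verts G \<noteq> {}" "X \<in> Sym G"
  shows "X + eps_matrix G X *\<^sub>R partial_id G \<in> psd_completable G"
    and eps_matrix_le: "X + \<epsilon> *\<^sub>R partial_id G \<in> psd_completable G \<Longrightarrow> eps_matrix G X \<le> \<epsilon>"
proof -
  obtain e where e: "X + e *\<^sub>R partial_id G \<in> psd_completable G"
    "\<And>\<epsilon>. X + \<epsilon> *\<^sub>R partial_id G \<in> psd_completable G \<Longrightarrow> e \<le> \<epsilon>"
    using eps_matrix_least_exists[OF assms] by blast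
  then have "eps_matrix G X = e"
    unfolding eps_matrix_def by (intro Least_equality) auto
  with e show "X + eps_matrix G X *\<^sub>R partial_id G \<in> psd_completable G"
    "X + \<epsilon> *\<^sub>R partial_id G \<in> psd_completable G \<Longrightarrow> eps_matrix G X \<le> \<epsilon>" by auto
qed

text \<open>An optimal shift for \<open>Y\<close> and a crude shift for \<open>X - Y\<close> add up
  to a feasible shift for \<open>X\<close>.\<close>

lemma eps_matrix_diff_le:
  fixes X Y :: "real^'n::finite^'n"
  assumes G: "looped_graph G" "verts G \<noteq> {}" and X: "X \<in> Sym G" and Y: "Y \<in> Sym G"
  shows "eps_matrix G X - eps_matrix G Y \<le> (\<Sum>i\<in>UNIV. \<Sum>j\<in>UNIV. \<bar>(X - Y) $ i $ j\<bar>)"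
    (is "_ \<le> ?s")
proof -
  have "(Y + eps_matrix G Y *\<^sub>R partial_id G) + ((X - Y) + ?s *\<^sub>R partial_id G) \<in> psd_completable G"
    by (intro psd_completable_add eps_matrix_attained psd_completable_shift Sym_diff assms order_refl)
  then have "X + (eps_matrix G Y + ?s) *\<^sub>R partial_id G \<in> psd_completable G"
    by (simp only: scaleR_left_distrib) (simp add: algebra_simps)
  then have "eps_matrix G X \<le> eps_matrix G Y + ?s"
    by (rule eps_matrix_le[OF G X])
  then show ?thesis by linarith
qed

lemma continuous_on_eps_matrix:
  assumes G: "looped_graph G" "verts G \<noteq> {}"
  shows "continuous_on (Sym G) (eps_matrix G)"
  unfolding continuous_on_def
proof
  fix X assume X: "X \<in> Sym G"
  let ?s = "\<lambda>Y. \<Sum>i\<in>UNIV. \<Sum>j\<in>UNIV. \<bar>(Y - X) $ i $ j\<bar>"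
  have "((\<lambda>Y. eps_matrix G Y - eps_matrix G X) \<longlongrightarrow> 0) (at X within Sym G)"
  proof (rule Lim_null_comparison)
    have "\<bar>eps_matrix G Y - eps_matrix G X\<bar> \<le> ?s Y" if "Y \<in> Sym G" for Y
      using eps_matrix_diff_le[OF G that X] eps_matrix_diff_le[OF G X that]
      by (simp add: abs_minus_commute abs_le_iff)
    then show "\<forall>\<^sub>F Y in at X within Sym G. norm (eps_matrix G Y - eps_matrix G X) \<le> ?s Y"
      by (auto simp: eventually_at_filter)
    have "(?s \<longlongrightarrow> (\<Sum>i\<in>UNIV. \<Sum>j\<in>UNIV. \<bar>(X - X) $ i $ j\<bar>)) (at X within Sym G)"
      by (intro tendsto_intros)
    then show "(?s \<longlongrightarrow> 0) (at X within Sym G)" by simp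
  qed
  then show "(eps_matrix G \<longlongrightarrow> eps_matrix G X) (at X within Sym G)"
    by (simp add: LIM_zero_iff)
qed

text \<open>The rank 1 projection onto a coordinate axis. It shows that the base is nonempty, and it
  is the test matrix for the sign of \<open>eps_graph\<close>.\<close>

definition diag_unit :: "'n::finite \<Rightarrow> real^'n^'n" where
  "diag_unit k = (\<chi> i j. if i = k \<and> j = k then 1 else 0)"

lemma diag_unit_in_base:
  assumes "looped_graph G" "k \<in> verts G"
  shows "diag_unit k \<in> locally_psd_base G"
proof -
  have "diag_unit k \<in> Sym G"
    using assms looped_loop[OF assms(1)]
    by (auto simp: Sym_def diag_unit_def vec_eq_iff transpose_def)
  moreover have "psd (principal_submatrix C (diag_unit k))" for C
  proof -
    have "(\<Sum>i\<in>C. \<Sum>j\<in>C. f i * diag_unit k $ i $ j * f j) =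
        (\<Sum>i\<in>C. \<Sum>j\<in>C. (if i = k then f i else 0) * (if j = k then f j else 0))" for f
      by (intro sum.cong) (auto simp: diag_unit_def)
    then have "(\<Sum>i\<in>C. \<Sum>j\<in>C. f i * diag_unit k $ i $ j * f j) =
        (\<Sum>i\<in>C. if i = k then f i else 0)\<^sup>2" for f
      by (simp only: power2_eq_square sum_product)
    then show ?thesis by (auto simp: psd_principal_iff diag_unit_def)
  qed
  moreover have "trace (diag_unit k) = 1"
    by (simp add: trace_def diag_unit_def)
  ultimately show ?thesis by (simp add: locally_psd_base_def locally_psd_def)
qed

text \<open>A continuous function on a nonempty compact set attains its maximum, so the
  \<open>GREATEST\<close> in \<open>eps_graph\<close> denotes it.\<close>

lemma eps_graph_attained:
  assumes G: "looped_graph G" "verts G \<noteq> {}"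
  shows "\<exists>X\<in>locally_psd_base G. eps_graph G = eps_matrix G X"
    and eps_matrix_le_eps_graph: "X \<in> locally_psd_base G \<Longrightarrow> eps_matrix G X \<le> eps_graph G"
proof -
  have "locally_psd_base G \<noteq> {}" using G diag_unit_in_base by blast
  moreover have "continuous_on (locally_psd_base G) (eps_matrix G)"
    by (rule continuous_on_subset[OF continuous_on_eps_matrix[OF G]])
      (auto simp: locally_psd_base_def locally_psd_Sym)
  ultimately obtain Z where Z: "Z \<in> locally_psd_base G"
    "\<And>X. X \<in> locally_psd_base G \<Longrightarrow> eps_matrix G X \<le> eps_matrix G Z"
    using continuous_attains_sup[OF compact_locally_psd_base[OF G(1)]] by blast
  then have "eps_graph G = eps_matrix G Z"
    unfolding eps_graph_def
    by (intro Greatest_equality) (auto simp: locally_psd_base_def)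
  with Z show "\<exists>X\<in>locally_psd_base G. eps_graph G = eps_matrix G X"
    "X \<in> locally_psd_base G \<Longrightarrow> eps_matrix G X \<le> eps_graph G" by auto
qed

text \<open>The matrix \<open>diag_unit a\<close> vanishes at position \<open>(b, b)\<close>, so a
  negative shift would make that diagonal entry negative. On a graph with one vertex the value is
  -1.\<close>

lemma eps_graph_nonneg:
  assumes G: "looped_graph G" and ab: "a \<in> verts G" "b \<in> verts G" "a \<noteq> b"
  shows "0 \<le> eps_graph G"
proof -
  have ne: "verts G \<noteq> {}" using ab by blast
  have K: "diag_unit a \<in> locally_psd_base G" by (rule diag_unit_in_base[OF G ab(1)])
  then have "diag_unit a \<in> Sym G" by (simp add: locally_psd_base_def locally_psd_Sym)
  then have "0 \<le> (diag_unit a + eps_matrix G (diag_unit a) *\<^sub>R partial_id G) $ b $ b"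
    using psd_completable_diag[OF G eps_matrix_attained(1)[OF G ne] ab(2)] by blast
  then have "0 \<le> eps_matrix G (diag_unit a)"
    using ab by (simp add: diag_unit_def partial_id_nth)
  also have "\<dots> \<le> eps_graph G" by (rule eps_matrix_le_eps_graph[OF G ne K])
  finally show ?thesis .
qed

section \<open>Locally rank 1 partial matrices and cocycles\<close>

text \<open>All rows are multiples of one vector, so every 2 by 2 minor vanishes.\<close>

lemma rank_le_1_minor:
  fixes A :: "real^'n::finite^'m::finite"
  assumes "rank A \<le> 1"
  shows "A $ i $ j * A $ k $ l = A $ i $ l * A $ k $ j"
proof -
  obtain B where B: "B \<subseteq> rows A" "independent B" "rows A \<subseteq> span B" "card B = dim (rows A)"
    using basis_exists by blast
  have fin: "finite B" using B(2) by (rule independent_imp_finite)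
  have "card B \<le> 1" using assms B(4) by (simp add: row_rank_def)
  then obtain r where "B \<subseteq> {r}"
    using fin by (metis card_le_Suc0_iff_eq One_nat_def empty_subsetI insert_subset subsetI singletonI)
  then have "rows A \<subseteq> span {r}" using B(3) span_mono by blast
  then have "\<exists>c. A $ i = c *\<^sub>R r" for i
    by (auto simp: span_singleton rows_def row_def vec_nth_inverse)
  then obtain c where "\<And>i. A $ i = c i *\<^sub>R r" by metis
  then show ?thesis by simp
qed

lemma locally_rank1_minor:
  assumes "locally_rank1 G X" "clique G C" "i \<in> C" "j \<in> C" "k \<in> C" "l \<in> C"
  shows "X $ i $ j * X $ k $ l = X $ i $ l * X $ k $ j"
  using rank_le_1_minor[of "principal_submatrix C X" i j k l] assms
  by (auto simp: locally_rank1_def principal_submatrix_def)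

text \<open>The isomorphism from the additive group of \<open>bit\<close> to the signs 1 and -1; it
  turns cocycle relations into products of signs.\<close>

definition bit_sign :: "bit \<Rightarrow> real" where
  "bit_sign b = (if b = 0 then 1 else -1)"

lemma bit_sign_add: "bit_sign (a + b) = bit_sign a * bit_sign b"
  by (cases a; cases b) (auto simp: bit_sign_def)

lemma bit_sign_square: "bit_sign a * bit_sign a = 1"
  by (simp add: bit_sign_def)

lemma bit_sign_0 [simp]: "bit_sign 0 = 1"
  by (simp add: bit_sign_def)

text \<open>Vanishing on loops supplies the degenerate cases of the triangle relation.\<close>

lemma cocycle_clique:
  assumes f: "f \<in> cocycles G" and C: "clique G C" "i \<in> C" "j \<in> C" "k \<in> C"
  shows "f {i, k} = f {i, j} + f {j, k}"
proof -
  have v: "i \<in> verts G" "j \<in> verts G" "k \<in> verts G" using C by (auto simp: clique_def)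
  have loop: "f {x, x} = 0" if "x \<in> verts G" for x
    using f that unfolding cocycles_def by blast
  consider "i = j" | "j = k" | "i = k" | "card {i, j, k} = 3" by fastforce
  then show ?thesis
  proof cases
    case 1
    then show ?thesis using loop[OF v(1)] by simp
  next
    case 2
    then show ?thesis using loop[OF v(2)] by simp
  next
    case 3
    then show ?thesis using loop[OF v(1)] bit_add_self[of "f {i, j}"] by (simp add: insert_commute)
  next
    case 4
    moreover have "{i, j, k} \<subseteq> C" using C by simp
    then have "clique G {i, j, k}" using C(1) unfolding clique_def by blast
    ultimately have "f {i, j} + f {j, k} + f {i, k} = 0"
      using f unfolding cocycles_def by blast
    then show ?thesis
      by (cases "f {i, j}"; cases "f {j, k}"; cases "f {i, k}") simp_all
  qed
qed

text \<open>Passes from cosets to representatives: if the class of \<open>s\<close> is the image of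
  the class of \<open>t\<close>, then \<open>s\<close> and the pullback of \<open>t\<close> differ
  by a coboundary.\<close>

lemma surjective_in_degree_1_cocycle:
  assumes G: "looped_graph G" and H: "looped_graph H" and hom: "graph_hom G H \<phi>"
    and surj: "surjective_in_degree_1 G H \<phi>" and s: "s \<in> cocycles G"
  obtains t d where "t \<in> cocycles H"
    and "\<And>i j. {i, j} \<in> edges G \<Longrightarrow> s {i, j} = t {\<phi> i, \<phi> j} + (d i + d j)"
proof -
  interpret N: normal "coboundaries G" "cocycle_group G"
    by (rule normal_coboundaries[OF G])
  have sc: "s \<in> carrier (cocycle_group G)" using s by (simp add: cocycle_group_def)
  then have "coboundaries G #>\<^bsub>cocycle_group G\<^esub> s \<in> carrier (H1 G)"
    unfolding H1_def FactGroup_def RCOSETS_def by auto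
  then have "coboundaries G #>\<^bsub>cocycle_group G\<^esub> s \<in> H1_map G \<phi> ` carrier (H1 H)"
    using surj by (simp add: surjective_in_degree_1_def)
  then obtain t where t: "t \<in> cocycles H" and
    "coboundaries G #>\<^bsub>cocycle_group G\<^esub> s = H1_map G \<phi> (coboundaries H #>\<^bsub>cocycle_group H\<^esub> t)"
    unfolding H1_def FactGroup_def RCOSETS_def by (auto simp: cocycle_group_def)
  then have "coboundaries G #>\<^bsub>cocycle_group G\<^esub> s =
      coboundaries G #>\<^bsub>cocycle_group G\<^esub> pullback G \<phi> t"
    using H1_map_coset[OF G H hom t] by simp
  then have "s \<in> coboundaries G #>\<^bsub>cocycle_group G\<^esub> pullback G \<phi> t"
    using N.rcos_self[OF sc N.is_subgroup] by simp
  then obtain b where b: "b \<in> coboundaries G" "s = (\<lambda>e. b e + pullback G \<phi> t e)"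
    by (auto simp: r_coset_def cocycle_group_def)
  then obtain d where d: "\<And>i j. {i, j} \<in> edges G \<Longrightarrow> b {i, j} = d i + d j"
    unfolding coboundaries_def by blast
  have "s {i, j} = t {\<phi> i, \<phi> j} + (d i + d j)" if "{i, j} \<in> edges G" for i j
  proof -
    have "pullback G \<phi> t {i, j} = t {\<phi> i, \<phi> j}" using that by (simp add: pullback_def)
    then show ?thesis by (simp only: b(2) d[OF that] add.commute)
  qed
  with t that show ?thesis by blast
qed

text \<open>A form pulled back along \<phi> is the original form evaluated at the fibre sums of
  \<open>g\<close>, so nonnegativity carries over from \<open>M\<close>.\<close>

lemma sum_fibres:
  fixes g :: "'a \<Rightarrow> real"
  assumes "finite V" "finite W" "\<phi> ` V \<subseteq> W"
  shows "(\<Sum>i\<in>V. \<Sum>j\<in>V. g i * M (\<phi> i) (\<phi> j) * g j) =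
    (\<Sum>a\<in>W. \<Sum>b\<in>W. (\<Sum>i\<in>{i \<in> V. \<phi> i = a}. g i) * M a b * (\<Sum>j\<in>{j \<in> V. \<phi> j = b}. g j))"
proof -
  have "(\<Sum>i\<in>V. \<Sum>j\<in>V. g i * M (\<phi> i) (\<phi> j) * g j) =
      (\<Sum>a\<in>W. \<Sum>i\<in>{i \<in> V. \<phi> i = a}. \<Sum>b\<in>W. \<Sum>j\<in>{j \<in> V. \<phi> j = b}. g i * M (\<phi> i) (\<phi> j) * g j)"
    by (simp only: sum.group[OF assms])
  also have "\<dots> = (\<Sum>a\<in>W. \<Sum>i\<in>{i \<in> V. \<phi> i = a}. \<Sum>b\<in>W. \<Sum>j\<in>{j \<in> V. \<phi> j = b}. g i * M a b * g j)"
    by (intro sum.cong) auto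
  also have "\<dots> = (\<Sum>a\<in>W. \<Sum>b\<in>W. \<Sum>i\<in>{i \<in> V. \<phi> i = a}. \<Sum>j\<in>{j \<in> V. \<phi> j = b}. g i * M a b * g j)"
    by (intro sum.cong refl sum.swap)
  also have "\<dots> = (\<Sum>a\<in>W. \<Sum>b\<in>W. (\<Sum>i\<in>{i \<in> V. \<phi> i = a}. g i) * M a b * (\<Sum>j\<in>{j \<in> V. \<phi> j = b}. g j))"
    by (simp only: sum_product[symmetric] sum_distrib_right[symmetric])
  finally show ?thesis .
qed

text \<open>On the support of \<open>X\<close> the signs of the entries form a cocycle.  It is the pullback of a cocycle
  \<open>t\<close> of \<open>H\<close> up to a coboundary, which is absorbed into the signs of \<open>x\<close>.\<close>

lemma locally_rank1_factorization:
  fixes G :: "'a::finite graph" and H :: "'b::finite graph"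
  assumes G: "looped_graph G" and H: "looped_graph H" and hom: "graph_hom G H \<phi>"
    and surj: "completely_surjective G H \<phi>"
    and X: "X \<in> locally_psd G" "locally_rank1 G X"
  obtains t x where "t \<in> cocycles H" and "\<And>i. x i * x i = X $ i $ i"
    and "\<And>i j. {i, j} \<in> edges G \<Longrightarrow> X $ i $ j = bit_sign (t {\<phi> i, \<phi> j}) * x i * x j"
proof -
  note XS = locally_psd_Sym[OF X(1)]
  note comm = Sym_nth_commute[OF XS]
  \<comment> \<open>Along an edge within the support the entry is nonzero and has a definite sign.
    The support may be any vertex set, which is where surjectivity for induced subgraphs
    enters.\<close>
  define S where "S = {i \<in> verts G. X $ i $ i \<noteq> 0}"
  define K where "K = induced_subgraph G S"
  have edgeK: "{i, j} \<in> edges K \<longleftrightarrow> {i, j} \<in> edges G \<and> i \<in> S \<and> j \<in> S" for i j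
    by (auto simp: K_def induced_subgraph_def)
  have K: "looped_graph K"
    unfolding K_def by (rule looped_graph_induced[OF G]) (auto simp: S_def)
  have homK: "graph_hom K H \<phi>"
    using hom edgeK by (auto simp: graph_hom_def K_def induced_subgraph_def S_def)
  have surjK: "surjective_in_degree_1 K H \<phi>"
    using surj unfolding completely_surjective_def K_def S_def by auto
  have cliqueK: "clique G C" "C \<subseteq> S" if "clique K C" for C
    using that edgeK by (auto simp: clique_def K_def induced_subgraph_def S_def)
  have diag_pos: "0 < X $ i $ i" if "i \<in> S" for i
    using that locally_psd_diag[OF G X(1), of i] by (simp add: S_def less_le)
  have square: "X $ i $ j * X $ i $ j = X $ i $ i * X $ j $ j" if "{i, j} \<in> edges G" for i j
    using locally_rank1_minor[OF X(2) looped_clique_edge[OF G that], of i j j i] comm[of i j]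
    by simp
  \<comment> \<open>An edge is an unordered set, hence the existential; symmetry of \<open>X\<close>
    makes the sign independent of the order.\<close>
  define s where "s e = (if e \<in> edges K \<and> (\<exists>i j. e = {i, j} \<and> X $ i $ j < 0) then 1 else 0 :: bit)" for e
  have s: "s {i, j} = (if X $ i $ j < 0 then 1 else 0)" if "{i, j} \<in> edges K" for i j
    using that comm[of i j] by (auto simp: s_def doubleton_eq_iff)
  have entry: "X $ i $ j = bit_sign (s {i, j}) * sqrt (X $ i $ i) * sqrt (X $ j $ j)"
    if e: "{i, j} \<in> edges K" for i j
  proof -
    have "\<bar>X $ i $ j\<bar> = sqrt (X $ i $ j * X $ i $ j)"
      by (simp add: real_sqrt_abs2)
    also have "\<dots> = sqrt (X $ i $ i) * sqrt (X $ j $ j)"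
      using square e edgeK by (simp add: real_sqrt_mult)
    finally have "\<bar>X $ i $ j\<bar> = sqrt (X $ i $ i) * sqrt (X $ j $ j)" .
    then show ?thesis by (auto simp: s[OF e] bit_sign_def)
  qed
  have cocycle: "s \<in> cocycles K"
  proof -
    have "s {i, i} = 0" if "i \<in> verts K" for i
      using that looped_loop[OF K, of i] s[of i i] diag_pos[of i]
      by (auto simp: K_def induced_subgraph_def)
    moreover have "s {i, j} + s {j, k} + s {i, k} = 0" if c: "clique K {i, j, k}" for i j k
    proof -
      have e: "{i, j} \<in> edges K" "{j, k} \<in> edges K" "{i, k} \<in> edges K"
        using c by (auto simp: clique_def)
      have S: "i \<in> S" "j \<in> S" "k \<in> S" using cliqueK(2)[OF c] by auto
      \<comment> \<open>As the diagonal entry at \<open>j\<close> is positive, comparing signs in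
        this minor gives the cocycle relation.\<close>
      have m: "X $ i $ j * X $ j $ k = X $ i $ k * X $ j $ j"
        using locally_rank1_minor[OF X(2) cliqueK(1)[OF c], of i j j k] by simp
      have "bit_sign (s {i, j}) * bit_sign (s {j, k}) = bit_sign (s {i, k})"
      proof -
        let ?p = "sqrt (X $ i $ i) * (sqrt (X $ j $ j) * sqrt (X $ j $ j)) * sqrt (X $ k $ k)"
        have "?p \<noteq> 0" using diag_pos[OF S(1)] diag_pos[OF S(2)] diag_pos[OF S(3)] by simp
        moreover have "bit_sign (s {i, j}) * bit_sign (s {j, k}) * ?p = bit_sign (s {i, k}) * ?p"
        proof -
          have "bit_sign (s {i, j}) * bit_sign (s {j, k}) * ?p = X $ i $ j * X $ j $ k"
            by (subst entry[OF e(1)], subst entry[OF e(2)]) (simp only: mult_ac)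
          also have "\<dots> = X $ i $ k * (sqrt (X $ j $ j) * sqrt (X $ j $ j))"
            using m diag_pos[OF S(2)] by simp
          also have "\<dots> = bit_sign (s {i, k}) * ?p"
            by (subst entry[OF e(3)]) (simp only: mult_ac)
          finally show ?thesis .
        qed
        ultimately show ?thesis by simp
      qed
      then show ?thesis
        by (cases "s {i, j}"; cases "s {j, k}"; cases "s {i, k}") (simp_all add: bit_sign_def)
    qed
    moreover have "s e = 0" if "e \<notin> edges K" for e using that by (simp add: s_def)
    ultimately show ?thesis unfolding cocycles_def by blast
  qed
  obtain t d where t: "t \<in> cocycles H"
    and td: "\<And>i j. {i, j} \<in> edges K \<Longrightarrow> s {i, j} = t {\<phi> i, \<phi> j} + (d i + d j)"
    using surjective_in_degree_1_cocycle[OF K H homK surjK cocycle] by blast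
  define x where "x i = bit_sign (d i) * sqrt (X $ i $ i)" for i
  have xx: "x i * x i = X $ i $ i" for i
  proof -
    have "x i * x i = (bit_sign (d i) * bit_sign (d i)) * (sqrt (X $ i $ i) * sqrt (X $ i $ i))"
      by (simp add: x_def)
    then show ?thesis using locally_psd_diag[OF G X(1), of i] by (simp add: bit_sign_square)
  qed
  have "X $ i $ j = bit_sign (t {\<phi> i, \<phi> j}) * x i * x j" if e: "{i, j} \<in> edges G" for i j
  proof (cases "i \<in> S \<and> j \<in> S")
    case True
    then have eK: "{i, j} \<in> edges K" using e edgeK by simp
    show ?thesis
      by (subst entry[OF eK]) (simp only: td[OF eK] bit_sign_add x_def mult_ac)
  next
    case False
    \<comment> \<open>Off the support both sides vanish: a zero diagonal entry annihilates the entry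
      at the edge as well as the value of \<open>x\<close>.\<close>
    then have "X $ i $ i = 0 \<or> X $ j $ j = 0" using looped_edgeD[OF G e] by (auto simp: S_def)
    with square[OF e] xx[of i] xx[of j] show ?thesis by auto
  qed
  with that t xx show ?thesis by blast
qed

text \<open>The shift \<open>e\<close> is kept apart from \<epsilon> because the value available for
  \<open>Y\<close> is \<open>eps_matrix H Y\<close>, whereas the final shift is
  \<open>eps_graph H\<close>, the same for all \<open>X\<close>.\<close>

lemma completable_of_locally_rank1:
  fixes G :: "'a::finite graph" and H :: "'b::finite graph"
  assumes G: "looped_graph G" and H: "looped_graph H" and hom: "graph_hom G H \<phi>"
    and surj: "completely_surjective G H \<phi>"
    and X: "X \<in> locally_psd G" "locally_rank1 G X" "trace X = 1"
  obtains Y where "Y \<in> locally_psd_base H"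
    and "\<And>\<epsilon> e. Y + \<epsilon> *\<^sub>R partial_id H \<in> psd_completable H \<Longrightarrow> \<epsilon> \<le> e \<Longrightarrow>
      0 \<le> e \<or> card (verts G) = 1 \<Longrightarrow> X + e *\<^sub>R partial_id G \<in> psd_completable G"
proof -
  note XS = locally_psd_Sym[OF X(1)]
  obtain t x where t: "t \<in> cocycles H" and xx: "\<And>i. x i * x i = X $ i $ i"
    and Xx: "\<And>i j. {i, j} \<in> edges G \<Longrightarrow> X $ i $ j = bit_sign (t {\<phi> i, \<phi> j}) * x i * x j"
    using locally_rank1_factorization[OF G H hom surj X(1,2)] by blast
  let ?V = "verts G" and ?W = "verts H"
  have img: "\<phi> ` ?V \<subseteq> ?W" using hom by (auto simp: graph_hom_def)
  have x_off: "x i = 0" if "i \<notin> ?V" for i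
    using xx[of i] Sym_nth_zero[OF XS, of i i] looped_loop[OF G, of i] that by simp
  define y where "y a = sqrt (\<Sum>i\<in>{i \<in> ?V. \<phi> i = a}. (x i)\<^sup>2)" for a
  have yy: "y a * y a = (\<Sum>i\<in>{i \<in> ?V. \<phi> i = a}. (x i)\<^sup>2)" for a
    by (simp add: y_def sum_nonneg)
  have x_sum: "(\<Sum>i\<in>?V. (x i)\<^sup>2) = 1"
  proof -
    have "(\<Sum>i\<in>?V. (x i)\<^sup>2) = (\<Sum>i\<in>UNIV. (x i)\<^sup>2)"
      by (intro sum.mono_neutral_left) (auto simp: x_off)
    also have "\<dots> = 1" using X(3) by (simp add: trace_def power2_eq_square xx)
    finally show ?thesis .
  qed
  define Y where "Y = (\<chi> a b. if {a, b} \<in> edges H then bit_sign (t {a, b}) * y a * y b else 0)"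
  have Y_nth: "Y $ a $ b = (if {a, b} \<in> edges H then bit_sign (t {a, b}) * y a * y b else 0)" for a b
    by (simp add: Y_def)
  have YS: "Y \<in> Sym H"
    by (simp add: Sym_def Y_def vec_eq_iff transpose_def insert_commute)
  have "psd (principal_submatrix C Y)" if C: "clique H C" for C
  proof -
    have "0 \<le> (\<Sum>a\<in>C. \<Sum>b\<in>C. f a * Y $ a $ b * f b)" for f
    proof (cases "C = {}")
      case False
      then obtain c where c: "c \<in> C" by blast
      \<comment> \<open>On a clique the cocycle is a coboundary, with potential
        \<open>t {c, a}\<close> for a fixed base point \<open>c\<close>. So \<open>Y\<close>
        restricted to \<open>C\<close> has rank at most 1 and its form is a square.\<close>
      let ?h = "\<lambda>a. bit_sign (t {c, a}) * y a * f a"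
      have "(\<Sum>a\<in>C. \<Sum>b\<in>C. f a * Y $ a $ b * f b) = (\<Sum>a\<in>C. \<Sum>b\<in>C. ?h a * ?h b)"
      proof (intro sum.cong refl)
        fix a b assume ab: "a \<in> C" "b \<in> C"
        then have "{a, b} \<in> edges H" using C by (simp add: clique_def)
        moreover have "t {a, b} = t {c, a} + t {c, b}"
          using cocycle_clique[OF t C ab(1) c ab(2)] by (simp only: insert_commute[of a c])
        then have "bit_sign (t {a, b}) = bit_sign (t {c, a}) * bit_sign (t {c, b})"
          by (simp only: bit_sign_add)
        ultimately show "f a * Y $ a $ b * f b = ?h a * ?h b"
          by (simp add: Y_nth)
      qed
      also have "\<dots> = (\<Sum>a\<in>C. ?h a)\<^sup>2"
        by (simp only: power2_eq_square sum_product)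
      finally show ?thesis by simp
    qed simp
    then show ?thesis
      unfolding psd_principal_iff using Sym_nth_commute[OF YS] by blast
  qed
  then have "Y \<in> locally_psd H" using YS by (simp add: locally_psd_def)
  moreover have "trace Y = 1"
  proof -
    have loop: "Y $ a $ a = (if a \<in> ?W then y a * y a else 0)" for a
      using t looped_loop[OF H, of a] by (auto simp: Y_nth cocycles_def)
    have "trace Y = (\<Sum>a\<in>?W. \<Sum>i\<in>{i \<in> ?V. \<phi> i = a}. (x i)\<^sup>2)"
      unfolding trace_def
      by (intro sum.mono_neutral_cong_right) (auto simp: loop yy)
    also have "\<dots> = (\<Sum>i\<in>?V. (x i)\<^sup>2)"
      by (intro sum.group img) auto
    finally show ?thesis using x_sum by simp
  qed
  ultimately have YK: "Y \<in> locally_psd_base H" by (simp add: locally_psd_base_def)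
  have "X + e *\<^sub>R partial_id G \<in> psd_completable G"
    if ce: "Y + \<epsilon> *\<^sub>R partial_id H \<in> psd_completable H" and le: "\<epsilon> \<le> e"
      and e: "0 \<le> e \<or> card ?V = 1" for \<epsilon> e
  proof -
    obtain M where M: "\<And>a b. {a, b} \<in> edges H \<Longrightarrow> M $ a $ b = (Y + \<epsilon> *\<^sub>R partial_id H) $ a $ b"
      "psd (principal_submatrix ?W M)"
      using ce unfolding psd_completable_def by blast
    \<comment> \<open>If the fibre norm is 0, then \<open>x i = 0\<close> and division by 0 gives
      \<open>u i = 0\<close>, so \<open>uy\<close> still holds. The squares of \<open>u\<close> over
      that fibre then sum to 0 instead of 1, hence only an inequality in
      \<open>u_fibre\<close>.\<close>
    define u where "u i = x i / y (\<phi> i)" for i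
    have fibre_le: "(x i)\<^sup>2 \<le> y (\<phi> i) * y (\<phi> i)" if "i \<in> ?V" for i
      unfolding yy using that by (intro member_le_sum[where f = "\<lambda>i. (x i)\<^sup>2"]) auto
    have uy: "u i * y (\<phi> i) = x i" if "i \<in> ?V" for i
      using fibre_le[OF that] by (auto simp: u_def)
    have u_fibre: "(\<Sum>i\<in>{i \<in> ?V. \<phi> i = a}. (u i)\<^sup>2) \<le> 1" for a
    proof -
      have "(\<Sum>i\<in>{i \<in> ?V. \<phi> i = a}. (u i)\<^sup>2) = (\<Sum>i\<in>{i \<in> ?V. \<phi> i = a}. (x i)\<^sup>2 / (y a * y a))"
        by (intro sum.cong) (auto simp: u_def power_divide power2_eq_square)
      also have "\<dots> = y a * y a / (y a * y a)"
        by (simp only: yy sum_divide_distrib[symmetric])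
      also have "\<dots> \<le> 1" by simp
      finally show ?thesis .
    qed
    \<comment> \<open>Write B for the matrix with entries \<open>u i * u j\<close> within fibres and
      0 elsewhere. The pullback of \<open>M\<close> agrees with \<open>X\<close> plus \<epsilon> B
      on the edges, so subtracting \<epsilon> B and adding \<open>e\<close> times the identity gives
      the required entries.\<close>
    define N where "N = (\<chi> i j. u i * M $ (\<phi> i) $ (\<phi> j) * u j
        + e * of_bool (i = j) - \<epsilon> * (u i * of_bool (\<phi> i = \<phi> j) * u j))"
    have agree: "N $ i $ j = (X + e *\<^sub>R partial_id G) $ i $ j" if ij: "{i, j} \<in> edges G" for i j
    proof -
      have v: "i \<in> ?V" "j \<in> ?V" using looped_edgeD[OF G ij] by auto
      have eH: "{\<phi> i, \<phi> j} \<in> edges H" using hom ij by (simp add: graph_hom_def)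
      have MY: "M $ (\<phi> i) $ (\<phi> j) = bit_sign (t {\<phi> i, \<phi> j}) * y (\<phi> i) * y (\<phi> j)
          + \<epsilon> * of_bool (\<phi> i = \<phi> j)"
        using M(1)[OF eH] eH looped_edgeD[OF H eH] by (simp add: Y_nth partial_id_nth)
      have "u i * M $ (\<phi> i) $ (\<phi> j) * u j = bit_sign (t {\<phi> i, \<phi> j}) * (u i * y (\<phi> i)) * (u j * y (\<phi> j))
          + \<epsilon> * (u i * of_bool (\<phi> i = \<phi> j) * u j)"
        unfolding MY by (simp add: algebra_simps)
      also have "\<dots> = X $ i $ j + \<epsilon> * (u i * of_bool (\<phi> i = \<phi> j) * u j)"
        by (simp only: uy[OF v(1)] uy[OF v(2)] Xx[OF ij])
      finally show ?thesis using v by (simp add: N_def partial_id_nth)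
    qed
    have sym: "N $ i $ j = N $ j $ i" if "i \<in> ?V" "j \<in> ?V" for i j
    proof -
      have "M $ (\<phi> i) $ (\<phi> j) = M $ (\<phi> j) $ (\<phi> i)"
        using conjunct1[OF M(2)[unfolded psd_principal_iff]] img that by blast
      then show ?thesis
        by (cases "i = j"; cases "\<phi> i = \<phi> j") (simp_all add: N_def)
    qed
    have "0 \<le> (\<Sum>i\<in>?V. \<Sum>j\<in>?V. f i * N $ i $ j * f j)" for f
    proof -
      let ?g = "\<lambda>i. f i * u i"
      let ?w = "\<lambda>a. \<Sum>i\<in>{i \<in> ?V. \<phi> i = a}. ?g i"
      \<comment> \<open>The values at \<open>f\<close> of the quadratic forms of the identity and of
        B. As the pullback of \<open>M\<close> contributes a nonnegative amount, it remains to bound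
        \<epsilon> \<open>?b\<close> by \<open>e * ?q\<close>.\<close>
      let ?q = "\<Sum>i\<in>?V. (f i)\<^sup>2" and ?b = "\<Sum>a\<in>?W. (?w a)\<^sup>2"
      have expand: "(\<Sum>i\<in>?V. \<Sum>j\<in>?V. f i * N $ i $ j * f j) =
          (\<Sum>i\<in>?V. \<Sum>j\<in>?V. ?g i * M $ (\<phi> i) $ (\<phi> j) * ?g j)
          + (\<Sum>i\<in>?V. \<Sum>j\<in>?V. if i = j then e * (f i)\<^sup>2 else 0)
          - \<epsilon> * (\<Sum>i\<in>?V. \<Sum>j\<in>?V. ?g i * of_bool (\<phi> i = \<phi> j) * ?g j)"
        unfolding sum.distrib[symmetric] sum_distrib_left sum_subtractf[symmetric]
        by (intro sum.cong) (auto simp: N_def algebra_simps power2_eq_square)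
      have M_form: "(\<Sum>i\<in>?V. \<Sum>j\<in>?V. ?g i * M $ (\<phi> i) $ (\<phi> j) * ?g j) =
          (\<Sum>a\<in>?W. \<Sum>b\<in>?W. ?w a * M $ a $ b * ?w b)"
        by (rule sum_fibres[OF _ _ img, where M = "\<lambda>a b. M $ a $ b"]) auto
      have M_nonneg: "0 \<le> (\<Sum>a\<in>?W. \<Sum>b\<in>?W. ?w a * M $ a $ b * ?w b)"
        using conjunct2[OF M(2)[unfolded psd_principal_iff]] by (rule allE)
      have q_eq: "(\<Sum>i\<in>?V. \<Sum>j\<in>?V. if i = j then e * (f i)\<^sup>2 else 0) = e * ?q"
        by (simp add: sum_distrib_left)
      have b_eq: "(\<Sum>i\<in>?V. \<Sum>j\<in>?V. ?g i * of_bool (\<phi> i = \<phi> j) * ?g j) = ?b"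
      proof -
        have "(\<Sum>i\<in>?V. \<Sum>j\<in>?V. ?g i * of_bool (\<phi> i = \<phi> j) * ?g j) =
            (\<Sum>a\<in>?W. \<Sum>b\<in>?W. ?w a * of_bool (a = b) * ?w b)"
          by (rule sum_fibres[OF _ _ img, where M = "\<lambda>a b. of_bool (a = b)"]) auto
        also have "\<dots> = (\<Sum>a\<in>?W. \<Sum>b\<in>?W. if a = b then (?w a)\<^sup>2 else 0)"
          by (intro sum.cong) (auto simp: power2_eq_square)
        finally show ?thesis by simp
      qed
      have "\<epsilon> * ?b \<le> e * ?q"
      proof -
        have b0: "0 \<le> ?b" by (intro sum_nonneg) auto
        \<comment> \<open>Cauchy-Schwarz on each fibre, where \<open>u\<close> has norm at most
          1.\<close>
        have "?b \<le> (\<Sum>a\<in>?W. \<Sum>i\<in>{i \<in> ?V. \<phi> i = a}. (f i)\<^sup>2)"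
        proof (rule sum_mono)
          fix a
          have "(?w a)\<^sup>2 \<le> (\<Sum>i\<in>{i \<in> ?V. \<phi> i = a}. (f i)\<^sup>2) * (\<Sum>i\<in>{i \<in> ?V. \<phi> i = a}. (u i)\<^sup>2)"
            by (rule Cauchy_Schwarz_ineq_sum)
          also have "\<dots> \<le> (\<Sum>i\<in>{i \<in> ?V. \<phi> i = a}. (f i)\<^sup>2)"
            by (rule mult_right_le_one_le) (auto intro: sum_nonneg u_fibre)
          finally show "(?w a)\<^sup>2 \<le> (\<Sum>i\<in>{i \<in> ?V. \<phi> i = a}. (f i)\<^sup>2)" .
        qed
        also have "\<dots> = ?q" by (intro sum.group img) auto
        finally have bq: "?b \<le> ?q" .
        show ?thesis
        proof (cases "0 \<le> e")
          case True
          have "\<epsilon> * ?b \<le> e * ?b" by (rule mult_right_mono[OF le b0])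
          also have "\<dots> \<le> e * ?q" by (rule mult_left_mono[OF bq True])
          finally show ?thesis .
        next
          case False
          \<comment> \<open>With a single vertex, trace 1 gives \<open>u v\<close> the square 1, so
            the two forms coincide and the sign of \<open>e\<close> does not matter.\<close>
          then obtain v where v: "?V = {v}" using e by (auto simp: card_1_singleton_iff)
          then have "(x v)\<^sup>2 = 1" using x_sum by simp
          moreover have "{i \<in> ?V. \<phi> i = \<phi> v} = {v}" using v by auto
          then have "y (\<phi> v) * y (\<phi> v) = (x v)\<^sup>2"
            by (simp add: yy)
          ultimately have "(u v)\<^sup>2 = 1"
            by (simp add: u_def power_divide power2_eq_square)
          then have "?g v * ?g v = (f v)\<^sup>2"
            by (simp only: power_mult_distrib power2_eq_square[symmetric])
          then have "(\<Sum>i\<in>?V. \<Sum>j\<in>?V. ?g i * of_bool (\<phi> i = \<phi> j) * ?g j) = ?q"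
            unfolding v by simp
          then have "?b = ?q" by (simp only: b_eq)
          then show ?thesis using mult_right_mono[OF le b0] by simp
        qed
      qed
      then show ?thesis
        unfolding expand M_form q_eq b_eq using M_nonneg by linarith
    qed
    then have "psd (principal_submatrix ?V N)"
      unfolding psd_principal_iff using sym by blast
    then show ?thesis
      using Sym_shift[OF G XS] agree unfolding psd_completable_def by blast
  qed
  with YK that show ?thesis by blast
qed

section \<open>Reduction to extreme points and conclusion\<close>

theorem theorem3p7:
  fixes G :: "'a::finite graph" and H :: "'b::finite graph" and \<phi> :: "'a \<Rightarrow> 'b"
  assumes "looped_graph G" and "looped_graph H"
    and "verts G \<noteq> {}"
    and "card (verts H) = 1 \<Longrightarrow> card (verts G) = 1"
    and "extreme_local_rank1 G"
    and "graph_hom G H \<phi>"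
    and "completely_surjective G H \<phi>"
  shows "eps_graph G \<le> eps_graph H"
proof -
  note G = assms(1) and H = assms(2) and hom = assms(6)
  let ?e = "eps_graph H"
  have VH: "verts H \<noteq> {}" using assms(3) hom by (auto simp: graph_hom_def)
  \<comment> \<open>Two vertices of \<open>H\<close> make \<open>?e\<close> nonnegative. If
    \<open>H\<close> has just one, then \<open>?e\<close> is negative, and the assumption on
    cardinalities leaves only one vertex in \<open>G\<close>.\<close>
  have e: "0 \<le> ?e \<or> card (verts G) = 1"
  proof (cases "card (verts H) = 1")
    case False
    obtain a where a: "a \<in> verts H" using VH by blast
    with False obtain b where "b \<in> verts H" "a \<noteq> b"
      by (metis is_singletonI' is_singleton_altdef empty_iff)
    with a show ?thesis using eps_graph_nonneg[OF H] by blast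
  qed (use assms(4) in blast)
  \<comment> \<open>A translate of a convex cone, so it contains the whole base once it contains the
    extreme points.\<close>
  define T where "T = {X. X + ?e *\<^sub>R partial_id G \<in> psd_completable G}"
  have "{X. X extreme_point_of locally_psd_base G} \<subseteq> T"
  proof
    fix X assume "X \<in> {X. X extreme_point_of locally_psd_base G}"
    then have X: "X extreme_point_of locally_psd_base G" by simp
    then have XK: "X \<in> locally_psd G" "trace X = 1"
      by (auto simp: extreme_point_of_def locally_psd_base_def)
    have "X \<in> conic hull {X}" by (simp add: hull_inc)
    then have "locally_rank1 G X"
      using extreme_ray_of_base[OF G X] assms(5) unfolding extreme_local_rank1_def by blast
    then obtain Y where Y: "Y \<in> locally_psd_base H"
      and pull: "\<And>\<epsilon> e. Y + \<epsilon> *\<^sub>R partial_id H \<in> psd_completable H \<Longrightarrow> \<epsilon> \<le> e \<Longrightarrow>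
        0 \<le> e \<or> card (verts G) = 1 \<Longrightarrow> X + e *\<^sub>R partial_id G \<in> psd_completable G"
      using completable_of_locally_rank1[OF G H hom assms(7) XK(1) _ XK(2)] by blast
    have "Y \<in> Sym H" using Y by (simp add: locally_psd_base_def locally_psd_Sym)
    \<comment> \<open>The transfer is applied with \<epsilon> equal to
      \<open>eps_matrix H Y\<close>, which is at most \<open>?e\<close>.\<close>
    then have "X + ?e *\<^sub>R partial_id G \<in> psd_completable G"
      using pull eps_matrix_attained(1)[OF H VH] eps_matrix_le_eps_graph[OF H VH Y] e by blast
    then show "X \<in> T" by (simp add: T_def)
  qed
  moreover have "convex T"
  proof -
    have "T = (\<lambda>Z. Z + - (?e *\<^sub>R partial_id G)) ` psd_completable G"
      by (force simp: T_def image_iff)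
    then show ?thesis
      using convex_translation[OF convex_psd_completable, of "- (?e *\<^sub>R partial_id G)" G]
      by (simp add: add.commute image_def)
  qed
  ultimately have "convex hull {X. X extreme_point_of locally_psd_base G} \<subseteq> T"
    by (rule hull_minimal)
  then have base: "locally_psd_base G \<subseteq> T"
    using Krein_Milman_Minkowski[OF compact_locally_psd_base[OF G] convex_locally_psd_base] by simp
  obtain X where X: "X \<in> locally_psd_base G" "eps_graph G = eps_matrix G X"
    using eps_graph_attained[OF G assms(3)] by blast
  have "X \<in> Sym G" using X(1) by (simp add: locally_psd_base_def locally_psd_Sym)
  then have "eps_matrix G X \<le> ?e"
    using base X(1) by (intro eps_matrix_le[OF G assms(3)]) (auto simp: T_def)
  with X(2) show ?thesis by simp
qed

end
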